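(* For fixed $d \ge 1$, as $n \to \infty$ the expected number $\mathcal{G}_{d,n}$ of generators after $n$ observations in dimension $d$ satisfies $$\mathcal{G}_{d,n} = (\ln n)^{d-1} \sum_{j=0}^{d-1} a_{d,j} (\ln n)^{-j} + O\big(n^{-1}(\ln n)^{d-1}\big),$$ where $$a_{d,j} := \sum_{k=0}^{j} \binom{d}{d-j+k} \frac{(-1)^k \Gamma^{(k)}(d-j+k)}{k!\,(d-1-j)!},$$ and $\Gamma^{(k)}$ denotes the $k$-th derivative of the Gamma function. In particular $a_{d,0}=1$.
   Context: Let $X^{(1)}, X^{(2)}, \dots$ be i.i.d. random vectors uniformly distributed on $[0,1)^d$. For $x,y\in\mathbb{R}^d$, $x \prec y$ means $x_j<y_j$ for all $j$ and $x \le y$ means $x_j \le y_j$ for all $j$. After $n$ observations, the record-setting region is $S_n := \{x \in [0,1)^d : x \not\prec X^{(i)} \text{ for all } i \in [n]\}$; its generators are the minimal elements of $S_n$ with respect to $\le$. $\mathcal{G}_{d,n}$ is the expected number of generators of $S_n$. *)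

theory Defs
  imports "HOL-Probability.Probability" "HOL-Library.Landau_Symbols"
begin

definition unit_cube :: "nat \<Rightarrow> (nat \<Rightarrow> real) set" where
  "unit_cube d = PiE {..<d} (\<lambda>_. {0..<1})"

definition strictly_below :: "nat \<Rightarrow> (nat \<Rightarrow> real) \<Rightarrow> (nat \<Rightarrow> real) \<Rightarrow> bool" where
  "strictly_below d x y \<longleftrightarrow> (\<forall>j<d. x j < y j)"

definition weakly_below :: "nat \<Rightarrow> (nat \<Rightarrow> real) \<Rightarrow> (nat \<Rightarrow> real) \<Rightarrow> bool" where
  "weakly_below d x y \<longleftrightarrow> (\<forall>j<d. x j \<le> y j)"

definition record_region :: "nat \<Rightarrow> nat \<Rightarrow> (nat \<Rightarrow> nat \<Rightarrow> real) \<Rightarrow> (nat \<Rightarrow> real) set" where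
  "record_region d n X = {x \<in> unit_cube d. \<forall>i<n. \<not> strictly_below d x (X i)}"

definition generators :: "nat \<Rightarrow> nat \<Rightarrow> (nat \<Rightarrow> nat \<Rightarrow> real) \<Rightarrow> (nat \<Rightarrow> real) set" where
  "generators d n X = {g \<in> record_region d n X.
      \<forall>y \<in> record_region d n X. weakly_below d y g \<longrightarrow> y = g}"

definition obs_measure :: "nat \<Rightarrow> nat \<Rightarrow> (nat \<Rightarrow> nat \<Rightarrow> real) measure" where
  "obs_measure d n = PiM {..<n} (\<lambda>_. PiM {..<d} (\<lambda>_. uniform_measure lborel {0..<1::real}))"

definition expected_generators :: "nat \<Rightarrow> nat \<Rightarrow> real" where
  "expected_generators d n = (\<integral>X. real (card (generators d n X)) \<partial>obs_measure d n)"

definition coeff_a :: "nat \<Rightarrow> nat \<Rightarrow> real" where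
  "coeff_a d j = (\<Sum>k=0..j. real (d choose (d - j + k)) * (-1) ^ k
       * (deriv ^^ k) Gamma (real (d - j + k)) / (fact k * fact (d - 1 - j)))"

end

theory Submission
  imports Defs
begin

text \<open>
  Almost surely a generator is determined by the set \<open>J\<close> of its nonzero coordinates and an
  injection \<open>f\<close> of \<open>J\<close> into the observations: coordinate \<open>j\<close> is the \<open>j\<close>-th coordinate of
  observation \<open>f j\<close>, which strictly exceeds the generator in all other coordinates, while
  no observation exceeds it in all coordinates. Conditioning on the coordinates \<open>t j\<close> and writing
  \<open>m = card J\<close>, \<open>p = (\<Prod>j\<in>J. 1 - t j)\<close>, this has probability \<open>p ^ (m - 1) * (1 - p) ^ (n - m)\<close>; and \<open>p\<close> has
  density \<open>(- ln p) ^ (m - 1) / fact (m - 1)\<close> on the unit interval. Hence the expected number is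
  a sum over \<open>m\<close> of binomial coefficients times falling factorials of \<open>n\<close> times beta integrals with
  logarithmic weight. Replacing \<open>(1 - p) ^ (n - m)\<close> by \<open>exp (- n * p)\<close> costs a relative error \<open>O(1 / n)\<close>,
  and the substitution \<open>p = y / n\<close> turns the integral into a polynomial in \<open>ln n\<close> whose coefficients are
  the moments \<open>\<integral>y. exp (- y) * y powr (m - 1) * ln y ^ k\<close>, i.e. the derivatives of Gamma at \<open>m\<close>.
\<close>

section \<open>Derivatives of the Gamma function\<close>

definition gamma_weight :: "real \<Rightarrow> real \<Rightarrow> real" where
  "gamma_weight x t = indicator {0<..} t * (t powr (x - 1) * exp (- t))"

text \<open>The result of formally differentiating the Gamma integral \<open>k\<close> times under
  the integral sign; \<open>higher_deriv_Gamma\<close> confirms the identification for positive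
  \<open>x\<close>.\<close>

definition log_gamma_moment :: "real \<Rightarrow> nat \<Rightarrow> real" where
  "log_gamma_moment x k = (\<integral>t. gamma_weight x t * ln t ^ k \<partial>lborel)"

lemma gamma_weight_measurable [measurable]: "gamma_weight x \<in> borel_measurable borel"
  unfolding gamma_weight_def by measurable

lemma gamma_weight_nonneg: "gamma_weight x t \<ge> 0"
  by (simp add: gamma_weight_def)

lemma gamma_weight_shift:
  "t > 0 \<Longrightarrow> gamma_weight x t * t powr h = gamma_weight (x + h) t"
  by (simp add: gamma_weight_def algebra_simps flip: powr_add)

lemma gamma_weight_has_bochner_integral:
  assumes "x > 0"
  shows "has_bochner_integral lborel (gamma_weight x) (Gamma x)"
proof (rule has_bochner_integral_nn_integral)
  have "(\<integral>\<^sup>+ t. ennreal (gamma_weight x t) \<partial>lborel)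
      = (\<integral>\<^sup>+ t. ennreal (indicator {0..} t * t powr (x - 1) / exp t) \<partial>lborel)"
    by (intro nn_integral_cong) (auto simp: gamma_weight_def exp_minus field_simps indicator_def)
  then show "(\<integral>\<^sup>+ t. ennreal (gamma_weight x t) \<partial>lborel) = ennreal (Gamma x)"
    using Gamma_conv_nn_integral_real[OF assms] by simp
qed (use assms in \<open>auto simp: gamma_weight_nonneg Gamma_real_nonneg less_imp_le\<close>)

text \<open>One of the two powers equals the left side, depending on the sign of
  \<open>ln t\<close>. The bound trades logarithms for shifts of the Gamma parameter in both
  directions.\<close>

lemma exp_abs_ln_le:
  fixes t :: real
  assumes "t > 0"
  shows "exp (h * \<bar>ln t\<bar>) \<le> t powr h + t powr (- h)"
  using assms by (cases "ln t \<ge> 0") (auto simp: powr_def)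

lemma power_div_fact_le_exp:
  fixes x :: real
  assumes "x \<ge> 0"
  shows "x ^ k / fact k \<le> exp x"
proof -
  have "(\<Sum>i\<in>{k}. x ^ i /\<^sub>R fact i) \<le> exp x"
    unfolding exp_def using assms by (intro sum_le_suminf summable_exp_generic) auto
  then show ?thesis by (simp add: divide_inverse mult.commute)
qed

text \<open>Up to a constant, a power of |ln t| is at most \<open>t powr h + t powr (- h)\<close>,
  by comparing one term of the exponential series with its sum. With \<open>h = x / 2\<close> both
  shifted parameters stay positive, so the bound is a sum of convergent Gamma integrals.\<close>

lemma gamma_weight_ln_power_integrable:
  assumes "x > 0"
  shows "integrable lborel (\<lambda>t. gamma_weight x t * ln t ^ k)"
proof -
  define h where "h = x / 2"
  have h: "h > 0" "x - h > 0" using assms by (auto simp: h_def)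
  have "integrable lborel (gamma_weight (x + h))" "integrable lborel (gamma_weight (x - h))"
    using h gamma_weight_has_bochner_integral[of "x + h"] gamma_weight_has_bochner_integral[of "x - h"]
    by (auto simp: has_bochner_integral_iff)
  then have "integrable lborel (\<lambda>t. fact k / h ^ k * (gamma_weight (x + h) t + gamma_weight (x - h) t))"
    by (intro integrable_mult_right Bochner_Integration.integrable_add)
  then show ?thesis
  proof (rule Bochner_Integration.integrable_bound, goal_cases)
    case 2
    have "\<bar>gamma_weight x t * ln t ^ k\<bar>
          \<le> fact k / h ^ k * (gamma_weight (x + h) t + gamma_weight (x - h) t)" for t
    proof (cases "t > 0")
      case True
      have "(h * \<bar>ln t\<bar>) ^ k / fact k \<le> t powr h + t powr (- h)"
        using power_div_fact_le_exp[of "h * \<bar>ln t\<bar>" k] exp_abs_ln_le[OF True, of h] h by force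
      then have "\<bar>ln t\<bar> ^ k \<le> fact k / h ^ k * (t powr h + t powr (- h))"
        using h by (simp add: field_simps)
      then have "gamma_weight x t * \<bar>ln t\<bar> ^ k
            \<le> gamma_weight x t * (fact k / h ^ k * (t powr h + t powr (- h)))"
        by (intro mult_left_mono gamma_weight_nonneg)
      also have "\<dots> = fact k / h ^ k * (gamma_weight x t * t powr h + gamma_weight x t * t powr (- h))"
        by (simp add: algebra_simps)
      finally show ?thesis
        using gamma_weight_nonneg[of x t]
        by (simp add: abs_mult power_abs gamma_weight_shift[OF True])
    qed (auto simp: gamma_weight_def)
    then show ?case
      by (intro AE_I2) (metis abs_ge_self order_trans real_norm_def)
  qed auto
qed

text \<open>
  Expanding \<open>t powr h = exp (h * ln t)\<close> under the Gamma integral gives all derivatives at once.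
\<close>

lemma Gamma_sums_log_gamma_moment:
  assumes "\<bar>h\<bar> < x"
  shows "(\<lambda>k. log_gamma_moment x k / fact k * h ^ k) sums Gamma (x + h)"
proof -
  define s where "s K t = (\<Sum>k<K. gamma_weight x t * ln t ^ k / fact k * h ^ k)" for K t
  have x: "x > 0" using assms by simp
  have s_exp: "s K t = gamma_weight x t * (\<Sum>k<K. (h * ln t) ^ k /\<^sub>R fact k)" for K t
    unfolding s_def by (simp add: sum_distrib_left power_mult_distrib field_simps)
  \<comment> \<open>Dominated convergence: all partial sums of \<open>exp (h * ln t)\<close> are
    bounded by \<open>exp \<bar>h * ln t\<bar>\<close>, and |h| < x keeps both dominating Gamma
    integrals finite.\<close>
  have "(\<lambda>K. \<integral>t. s K t \<partial>lborel) \<longlonglongrightarrow> (\<integral>t. gamma_weight (x + h) t \<partial>lborel)"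
  proof (rule integral_dominated_convergence
      [where w = "\<lambda>t. gamma_weight (x + \<bar>h\<bar>) t + gamma_weight (x - \<bar>h\<bar>) t"])
    show "integrable lborel (\<lambda>t. gamma_weight (x + \<bar>h\<bar>) t + gamma_weight (x - \<bar>h\<bar>) t)"
      using assms gamma_weight_has_bochner_integral[of "x + \<bar>h\<bar>"]
        gamma_weight_has_bochner_integral[of "x - \<bar>h\<bar>"]
      by (auto simp: has_bochner_integral_iff)
    show "AE t in lborel. (\<lambda>K. s K t) \<longlonglongrightarrow> gamma_weight (x + h) t"
    proof (rule AE_I2)
      fix t
      have "(\<lambda>K. s K t) \<longlonglongrightarrow> gamma_weight x t * exp (h * ln t)"
        unfolding s_exp using exp_converges[of "h * ln t"]
        by (intro tendsto_mult tendsto_const) (simp add: sums_def)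
      moreover have "gamma_weight x t * exp (h * ln t) = gamma_weight (x + h) t"
        using gamma_weight_shift[of t x h]
        by (cases "t > 0") (auto simp: powr_def gamma_weight_def)
      ultimately show "(\<lambda>K. s K t) \<longlonglongrightarrow> gamma_weight (x + h) t" by simp
    qed
    show "AE t in lborel. norm (s K t) \<le> gamma_weight (x + \<bar>h\<bar>) t + gamma_weight (x - \<bar>h\<bar>) t" for K
    proof (rule AE_I2)
      fix t
      show "norm (s K t) \<le> gamma_weight (x + \<bar>h\<bar>) t + gamma_weight (x - \<bar>h\<bar>) t"
      proof (cases "t > 0")
        case True
        have "\<bar>\<Sum>k<K. (h * ln t) ^ k /\<^sub>R fact k\<bar> \<le> (\<Sum>k<K. \<bar>h * ln t\<bar> ^ k /\<^sub>R fact k)"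
          by (rule order_trans[OF sum_abs]) (simp add: power_abs abs_mult)
        also have "\<dots> \<le> exp \<bar>h * ln t\<bar>"
          unfolding exp_def by (intro sum_le_suminf summable_exp_generic) auto
        also have "\<dots> \<le> t powr \<bar>h\<bar> + t powr (- \<bar>h\<bar>)"
          using exp_abs_ln_le[OF True, of "\<bar>h\<bar>"] by (simp add: abs_mult)
        finally have "\<bar>s K t\<bar> \<le> gamma_weight x t * (t powr \<bar>h\<bar> + t powr (- \<bar>h\<bar>))"
          unfolding s_exp using gamma_weight_nonneg[of x t] by (simp add: abs_mult mult_left_mono)
        then show ?thesis
          by (simp add: gamma_weight_shift[OF True] distrib_left)
      qed (auto simp: s_def gamma_weight_def)
    qed
  qed (auto simp: s_def)
  moreover have "(\<integral>t. s K t \<partial>lborel) = (\<Sum>k<K. log_gamma_moment x k / fact k * h ^ k)" for K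
    unfolding s_def log_gamma_moment_def
    by (subst Bochner_Integration.integral_sum) (auto intro!: gamma_weight_ln_power_integrable x)
  moreover have "(\<integral>t. gamma_weight (x + h) t \<partial>lborel) = Gamma (x + h)"
    using gamma_weight_has_bochner_integral[of "x + h"] assms
    by (auto simp: has_bochner_integral_iff)
  ultimately show ?thesis by (simp add: sums_def)
qed

section \<open>From the power series of Gamma to its higher derivatives\<close>

lemma has_fps_expansion_higher_deriv:
  fixes f :: "real \<Rightarrow> real"
  assumes "f has_fps_expansion F"
  shows "(deriv ^^ k) f has_fps_expansion fps_nth_deriv k F"
proof (induction k)
  case (Suc k)
  \<comment> \<open>The new derivative is outermost for \<open>deriv ^^ Suc k\<close> but innermost
    in the recursion of \<open>fps_nth_deriv\<close>, hence the commutation rule.\<close>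
  from has_fps_expansion_deriv[OF this] show ?case
    by (simp add: fps_nth_deriv_commute del: fps_nth_deriv.simps)
qed (use assms in simp)

lemma higher_deriv_shift:
  fixes f :: "real \<Rightarrow> real"
  shows "(deriv ^^ k) (\<lambda>h. f (x + h)) = (\<lambda>h. (deriv ^^ k) f (x + h))"
proof (induction k)
  case (Suc k)
  have "deriv (\<lambda>h. g (x + h)) = (\<lambda>h. deriv g (x + h))" for g :: "real \<Rightarrow> real"
    by (simp add: fun_eq_iff deriv_def DERIV_shift add.commute)
  from this[of "(deriv ^^ k) f"] show ?case
    by (simp add: Suc)
qed auto

text \<open>The expansion of Gamma around \<open>x\<close> has the moments divided by factorials as
  coefficients, so the constant term of its \<open>k\<close>-fold formal derivative is the
  \<open>k\<close>-th moment.\<close>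

lemma higher_deriv_Gamma:
  assumes "x > 0"
  shows "(deriv ^^ k) Gamma x = log_gamma_moment x k"
proof -
  define F where "F = Abs_fps (\<lambda>k. log_gamma_moment x k / fact k)"
  have "summable (\<lambda>k. fps_nth F k * h ^ k)" "eval_fps F h = Gamma (x + h)" if "\<bar>h\<bar> < x" for h
    using Gamma_sums_log_gamma_moment[OF that]
    by (auto simp: F_def eval_fps_def sums_iff)
  note F = this
  \<comment> \<open>Any positive radius will do; convergence at the single point
    \<open>x / 2\<close> provides one.\<close>
  have "fps_conv_radius F \<ge> ereal (x / 2)"
    unfolding fps_conv_radius_def
    using conv_radius_geI[of "fps_nth F" "x / 2"] F(1)[of "x / 2"] assms by simp
  then have rad: "fps_conv_radius F > 0"
    using assms by (metis ereal_less(2) half_gt_zero less_le_trans)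
  have "\<forall>\<^sub>F h in nhds 0. h \<in> {-x<..<x}"
    using assms by (intro eventually_nhds_in_open) auto
  then have "\<forall>\<^sub>F h in nhds 0. eval_fps F h = Gamma (x + h)"
    by eventually_elim (auto intro!: F(2))
  with rad have "(\<lambda>h. Gamma (x + h)) has_fps_expansion F"
    by (simp add: has_fps_expansion_def)
  from has_fps_expansion_higher_deriv[OF this, of k]
  have "(\<lambda>h. (deriv ^^ k) Gamma (x + h)) has_fps_expansion fps_nth_deriv k F"
    by (simp add: higher_deriv_shift)
  then have "(deriv ^^ k) Gamma (x + 0) = fps_nth (fps_nth_deriv k F) 0"
    unfolding has_fps_expansion_def eval_fps_at_0[symmetric]
    by (auto dest: eventually_nhds_x_imp_x)
  then show ?thesis
    by (simp add: fps_deriv_maclauren_0 F_def)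
qed

section \<open>Asymptotics of the beta integrals\<close>

text \<open>The integral of \<open>(L - ln y) ^ (m - 1)\<close> against
  \<open>gamma_weight m\<close> for \<open>m\<close> at least 1, expanded in powers of
  \<open>L\<close>. At \<open>L = ln n\<close> it is the main term belonging to index sets of size
  \<open>m\<close>.\<close>

definition log_poly :: "nat \<Rightarrow> real \<Rightarrow> real" where
  "log_poly m L = (\<Sum>i\<le>m - 1. real (m - 1 choose i) * (- 1) ^ i * log_gamma_moment m i * L ^ (m - 1 - i))"

text \<open>The factor \<open>(- ln p) ^ (m - 1)\<close> is the density of a product of
  \<open>m\<close> independent uniform variables, without its normalisation
  \<open>fact (m - 1)\<close>; the remaining factors are the conditional probability of a
  generator.\<close>

definition beta_log_integral :: "nat \<Rightarrow> nat \<Rightarrow> real" where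
  "beta_log_integral m N =
     (\<integral>p. indicator {0<..<1} p * (p ^ (m - 1) * (1 - p) ^ N * (- ln p) ^ (m - 1)) \<partial>lborel)"

lemma log_gamma_moment_binomial:
  assumes "x > 0"
  shows "has_bochner_integral lborel (\<lambda>y. gamma_weight x y * (L - ln y) ^ k)
     (\<Sum>i\<le>k. real (k choose i) * (- 1) ^ i * log_gamma_moment x i * L ^ (k - i))"
proof -
  have "gamma_weight x y * (L - ln y) ^ k
      = (\<Sum>i\<le>k. (real (k choose i) * (- 1) ^ i * L ^ (k - i)) * (gamma_weight x y * ln y ^ i))" for y
    using binomial_ring[of "- ln y" L k]
    by (simp add: sum_distrib_left power_minus[of "ln y"] mult_ac)
  moreover have "has_bochner_integral lborel
      (\<lambda>y. \<Sum>i\<le>k. (real (k choose i) * (- 1) ^ i * L ^ (k - i)) * (gamma_weight x y * ln y ^ i))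
      (\<Sum>i\<le>k. (real (k choose i) * (- 1) ^ i * L ^ (k - i)) * log_gamma_moment x i)"
    unfolding log_gamma_moment_def
    by (intro has_bochner_integral_sum has_bochner_integral_mult_right has_bochner_integral_integrable
        gamma_weight_ln_power_integrable assms)
  ultimately show ?thesis by (simp add: mult_ac)
qed

lemma gamma_weight_of_nat:
  assumes "m \<ge> 1"
  shows "gamma_weight (real m) y = indicator {0<..} y * (y ^ (m - 1) * exp (- y))"
  using assms powr_realpow[of y "m - 1"]
  by (auto simp: gamma_weight_def of_nat_diff indicator_def)

text \<open>Under \<open>p = y / n\<close> the term \<open>- ln p\<close> becomes
  \<open>ln n - ln y\<close>; the monomial contributes \<open>n\<close> to the power
  \<open>1 - m\<close>, and the Jacobian one further factor \<open>1 / n\<close>.\<close>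

lemma laplace_log_integral:
  fixes n m :: nat
  assumes "m \<ge> 1" "n \<ge> 1"
  shows "has_bochner_integral lborel
    (\<lambda>p. indicator {0<..} p * (p ^ (m - 1) * exp (- (real n * p)) * (- ln p) ^ (m - 1)))
    (log_poly m (ln n) / real n ^ m)"
proof -
  define f where "f p = indicator {0<..} p * (p ^ (m - 1) * exp (- (real n * p)) * (- ln p) ^ (m - 1))" for p
  \<comment> \<open>The argument is written in the form expected by the affine substitution rule
    applied at the end.\<close>
  have "f (0 + 1 / n * y) = (1 / real n ^ (m - 1)) * (gamma_weight m y * (ln n - ln y) ^ (m - 1))" for y
  proof (cases "y > 0")
    case True
    then show ?thesis using assms
      by (simp add: f_def gamma_weight_of_nat ln_div power_divide)
  qed (auto simp: f_def gamma_weight_def indicator_def zero_less_divide_iff)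
  moreover have "has_bochner_integral lborel
     (\<lambda>y. (1 / real n ^ (m - 1)) * (gamma_weight m y * (ln n - ln y) ^ (m - 1)))
     ((1 / real n ^ (m - 1)) * log_poly m (ln n))"
    unfolding log_poly_def using assms
    by (intro has_bochner_integral_mult_right log_gamma_moment_binomial) auto
  moreover have "(1 / real n ^ (m - 1)) * log_poly m (ln n) = (log_poly m (ln n) / real n ^ m) /\<^sub>R \<bar>1 / real n\<bar>"
    using assms by (simp add: field_simps flip: power_Suc)
  ultimately have "has_bochner_integral lborel (\<lambda>y. f (0 + 1 / n * y))
      ((log_poly m (ln n) / real n ^ m) /\<^sub>R \<bar>1 / real n\<bar>)"
    by simp
  then show ?thesis
    using lborel_has_bochner_integral_real_affine_iff[of "1 / n" f "log_poly m (ln n) / real n ^ m" 0] assms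
    unfolding f_def by simp
qed

text \<open>The upper bound uses \<open>1 - p \<le> exp (- p)\<close>, where the \<open>m\<close>
  missing factors cost at most \<open>exp (m * p)\<close>. The lower bound applies Bernoulli's
  inequality to \<open>(1 - p\<^sup>2) ^ n\<close> together with \<open>1 + p \<le> exp p\<close>.
  At the relevant scale \<open>p = y / n\<close> the relative error \<open>p + n * p\<^sup>2\<close>
  is of order \<open>1 / n\<close>.\<close>

lemma power_one_minus_exp_approx:
  fixes p :: real
  assumes "0 \<le> p" "p \<le> 1"
  shows "\<bar>(1 - p) ^ (n - m) - exp (- (real n * p))\<bar>
      \<le> (m * exp m + 1) * ((p + n * p\<^sup>2) * exp (- (real n * p)))"
proof -
  let ?e = "exp (- (real n * p))"
  have "(1 - p) ^ (n - m) \<le> exp (- p) ^ (n - m)"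
    using assms exp_ge_add_one_self[of "- p"] by (intro power_mono) auto
  also have "\<dots> = exp (- p * real (n - m))"
    by (simp add: exp_of_nat_mult[symmetric] mult.commute)
  also have "\<dots> \<le> exp (m * p) * ?e"
  proof -
    \<comment> \<open>An inequality rather than an equation, because \<open>n - m\<close> is
      truncated when \<open>m\<close> exceeds \<open>n\<close>.\<close>
    have "p * real n \<le> p * (real (n - m) + real m)"
      using assms by (intro mult_left_mono) auto
    then show ?thesis
      by (simp add: algebra_simps flip: exp_add)
  qed
  finally have 1: "(1 - p) ^ (n - m) - ?e \<le> (exp (m * p) - 1) * ?e"
    by (simp add: algebra_simps)
  \<comment> \<open>This is \<open>1 - x \<le> exp (- x)\<close> multiplied by \<open>exp x\<close>,
    at \<open>x = m * p\<close>.\<close>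
  have "exp (m * p) - 1 \<le> m * p * exp (m * p)"
    using exp_ge_add_one_self[of "- (m * p)"] by (simp add: exp_minus field_simps)
  also have "\<dots> \<le> m * p * exp m"
    using assms by (intro mult_left_mono) (auto simp: mult_left_le)
  also have "\<dots> \<le> (m * exp m + 1) * (p + n * p\<^sup>2)"
    using assms by (simp add: algebra_simps)
  finally have "(exp (m * p) - 1) * ?e \<le> (m * exp m + 1) * (p + n * p\<^sup>2) * ?e"
    by (intro mult_right_mono) auto
  from order_trans[OF 1 this]
  have upper: "(1 - p) ^ (n - m) - ?e \<le> (m * exp m + 1) * ((p + n * p\<^sup>2) * ?e)"
    by (simp only: mult.assoc)
  have "1 + real n * (- p\<^sup>2) \<le> (1 + (- p\<^sup>2)) ^ n"
    using assms by (intro Bernoulli_inequality) (auto simp: power_le_one)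
  also have "\<dots> \<le> ((1 - p) * exp p) ^ n"
  proof (intro power_mono)
    have "(1 - p) * (1 + p) \<le> (1 - p) * exp p"
      using assms exp_ge_add_one_self[of p] by (intro mult_left_mono) auto
    then show "1 + - p\<^sup>2 \<le> (1 - p) * exp p"
      by (simp add: power2_eq_square algebra_simps)
    show "0 \<le> 1 + - p\<^sup>2"
      using assms by (simp add: power_le_one)
  qed
  also have "\<dots> = (1 - p) ^ n * exp (n * p)"
    by (simp add: power_mult_distrib exp_of_nat_mult)
  also have "\<dots> \<le> (1 - p) ^ (n - m) * exp (n * p)"
    using assms by (intro mult_right_mono power_decreasing) auto
  finally have "(1 + real n * (- p\<^sup>2)) * ?e \<le> (1 - p) ^ (n - m) * exp (n * p) * ?e"
    by (intro mult_right_mono) auto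
  also have "\<dots> = (1 - p) ^ (n - m)"
    by (simp add: mult.assoc flip: exp_add)
  finally have "?e - (1 - p) ^ (n - m) \<le> n * p\<^sup>2 * ?e"
    by (simp add: algebra_simps)
  also have "\<dots> \<le> 1 * ((p + n * p\<^sup>2) * ?e)"
    using assms by (simp add: algebra_simps)
  also have "\<dots> \<le> (m * exp m + 1) * ((p + n * p\<^sup>2) * ?e)"
    using assms by (intro mult_right_mono) auto
  finally show ?thesis using upper by linarith
qed

text \<open>The substitution \<open>p = y / n\<close> turns \<open>p + n * p\<^sup>2\<close> into
  \<open>(y + y\<^sup>2) / n\<close>. This gains a factor \<open>1 / n\<close> and raises the Gamma
  parameter from \<open>m\<close> to \<open>m + 1\<close> and \<open>m + 2\<close>; the constant
  \<open>K\<close> is independent of \<open>n\<close>.\<close>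

lemma laplace_log_error_integral:
  fixes n m :: nat
  assumes "m \<ge> 1" "n \<ge> 3"
  defines "g \<equiv> \<lambda>p::real. indicator {0<..} p * ((p + n * p\<^sup>2) * exp (- (real n * p)) * (p ^ (m - 1) * \<bar>ln p\<bar> ^ (m - 1)))"
  defines "K \<equiv> \<integral>y. (gamma_weight (real (m + 1)) y + gamma_weight (real (m + 2)) y) * (1 + \<bar>ln y\<bar>) ^ (m - 1) \<partial>lborel"
  shows "integrable lborel g" "(\<integral>p. g p \<partial>lborel) \<le> K * ln n ^ (m - 1) / real n ^ (m + 1)"
proof -
  define w where "w y = gamma_weight (real (m + 1)) y + gamma_weight (real (m + 2)) y" for y
  have w_nonneg: "w y \<ge> 0" for y by (simp add: w_def gamma_weight_nonneg)
  have w_int: "integrable lborel (\<lambda>y. w y * (1 + \<bar>ln y\<bar>) ^ (m - 1))"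
  proof -
    have "integrable lborel (\<lambda>y. gamma_weight x y * \<bar>ln y\<bar> ^ i)" if "x > 0" for x i
      using integrable_norm[OF gamma_weight_ln_power_integrable[OF that, of i]]
      by (simp add: abs_mult power_abs gamma_weight_nonneg)
    then have "integrable lborel (\<lambda>y. \<Sum>i\<le>m - 1. real (m - 1 choose i) *
        (gamma_weight (real (m + 1)) y * \<bar>ln y\<bar> ^ i + gamma_weight (real (m + 2)) y * \<bar>ln y\<bar> ^ i))"
      by (intro Bochner_Integration.integrable_sum integrable_mult_right
          Bochner_Integration.integrable_add) auto
    moreover have "(1 + \<bar>ln y\<bar>) ^ (m - 1) = (\<Sum>i\<le>m - 1. real (m - 1 choose i) * \<bar>ln y\<bar> ^ i)" for y
      using binomial_ring[of "\<bar>ln y\<bar>" 1 "m - 1"] by (simp add: add.commute)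
    ultimately show ?thesis
      by (simp add: w_def sum_distrib_left algebra_simps)
  qed
  \<comment> \<open>Since e is at most 3, \<open>n \<ge> 3\<close> gives
    \<open>ln n \<ge> 1\<close>, which below allows \<open>ln n\<close> to be factored out of |ln n
    - ln y|.\<close>
  have ln_n: "ln (real n) \<ge> 1"
    using assms(2) exp_le by (subst ln_ge_iff) auto
  have g_scale: "g (0 + 1 / n * y) = w y * \<bar>ln n - ln y\<bar> ^ (m - 1) / real n ^ m" for y
  proof (cases "y > 0")
    case True
    then have "g (0 + 1 / n * y) = (y / n + y\<^sup>2 / n) * exp (- y) * (y ^ (m - 1) / n ^ (m - 1) * \<bar>ln n - ln y\<bar> ^ (m - 1))"
      using assms(1,2) by (simp add: g_def ln_div power_divide power2_eq_square abs_minus_commute)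
    also have "\<dots> = (y * y ^ (m - 1) + y\<^sup>2 * y ^ (m - 1)) * exp (- y) * \<bar>ln n - ln y\<bar> ^ (m - 1) / (real n * real n ^ (m - 1))"
      by (simp add: add_divide_distrib distrib_left distrib_right mult_ac)
    also have "\<dots> = (y ^ m + y ^ (m + 1)) * exp (- y) * \<bar>ln n - ln y\<bar> ^ (m - 1) / real n ^ m"
      using assms(1) by (cases m) (simp_all add: power2_eq_square)
    also have "(y ^ m + y ^ (m + 1)) * exp (- y) = w y"
      using True by (simp add: w_def gamma_weight_of_nat algebra_simps del: of_nat_add of_nat_Suc)
    finally show ?thesis .
  qed (auto simp: g_def w_def gamma_weight_def indicator_def zero_less_divide_iff)
  have bound: "g (0 + 1 / n * y) \<le> ln n ^ (m - 1) / real n ^ m * (w y * (1 + \<bar>ln y\<bar>) ^ (m - 1))" for y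
  proof -
    have "\<bar>ln n - ln y\<bar> \<le> ln n * (1 + \<bar>ln y\<bar>)"
    proof -
      have "1 * \<bar>ln y\<bar> \<le> ln n * \<bar>ln y\<bar>" using ln_n by (intro mult_right_mono) auto
      then show ?thesis using ln_n by (simp add: algebra_simps)
    qed
    then have "\<bar>ln n - ln y\<bar> ^ (m - 1) \<le> (ln n * (1 + \<bar>ln y\<bar>)) ^ (m - 1)"
      by (intro power_mono) auto
    then have "w y * \<bar>ln n - ln y\<bar> ^ (m - 1) / real n ^ m \<le> w y * (ln n * (1 + \<bar>ln y\<bar>)) ^ (m - 1) / real n ^ m"
      by (intro divide_right_mono mult_left_mono w_nonneg) auto
    then show ?thesis
      unfolding g_scale by (simp add: power_mult_distrib mult_ac)
  qed
  have g_nonneg: "g p \<ge> 0" for p by (auto simp: g_def indicator_def)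
  have [measurable]: "g \<in> borel_measurable borel" unfolding g_def by measurable
  have int_bound: "integrable lborel (\<lambda>y. ln n ^ (m - 1) / real n ^ m * (w y * (1 + \<bar>ln y\<bar>) ^ (m - 1)))"
    by (intro integrable_mult_right w_int)
  have int_scale: "integrable lborel (\<lambda>y. g (0 + 1 / n * y))"
  proof (rule Bochner_Integration.integrable_bound[OF int_bound], goal_cases)
    case 2
    show ?case
      unfolding real_norm_def abs_of_nonneg[OF g_nonneg]
      by (intro AE_I2 order_trans[OF bound abs_ge_self])
  qed measurable
  then show "integrable lborel g"
    using lborel_integrable_real_affine_iff[of "1 / n" g 0] assms(2) by simp
  have "(\<integral>p. g p \<partial>lborel) = \<bar>1 / n\<bar> *\<^sub>R (\<integral>y. g (0 + 1 / n * y) \<partial>lborel)"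
    using assms(2) by (intro lborel_integral_real_affine) auto
  also have "\<dots> \<le> \<bar>1 / n\<bar> *\<^sub>R (\<integral>y. ln n ^ (m - 1) / real n ^ m * (w y * (1 + \<bar>ln y\<bar>) ^ (m - 1)) \<partial>lborel)"
    by (intro scaleR_left_mono integral_mono int_scale int_bound bound) auto
  also have "\<dots> = K * ln n ^ (m - 1) / real n ^ (m + 1)"
    unfolding integral_mult_right_zero by (simp add: K_def w_def)
  finally show "(\<integral>p. g p \<partial>lborel) \<le> K * ln n ^ (m - 1) / real n ^ (m + 1)" .
qed

text \<open>The beta integrand and its exponential replacement differ pointwise by at most
  \<open>B * g\<close>, so the two preceding integrals combine. The constant \<open>B * K\<close>
  serves all \<open>n \<ge> 3\<close> at once.\<close>

lemma beta_log_integral_approx: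
  assumes "m \<ge> 1"
  shows "\<exists>C. \<forall>n\<ge>3. \<bar>beta_log_integral m (n - m) - log_poly m (ln (real n)) / real n ^ m\<bar>
             \<le> C * ln (real n) ^ (m - 1) / real n ^ (m + 1)"
proof -
  define K where "K = (\<integral>y. (gamma_weight (real (m + 1)) y + gamma_weight (real (m + 2)) y) * (1 + \<bar>ln y\<bar>) ^ (m - 1) \<partial>lborel)"
  define B where "B = m * exp m + 1"
  have "\<bar>beta_log_integral m (n - m) - log_poly m (ln (real n)) / real n ^ m\<bar>
             \<le> B * K * ln (real n) ^ (m - 1) / real n ^ (m + 1)" if n: "n \<ge> 3" for n
  proof -
    define f1 where "f1 p = indicator {0<..<1} p * (p ^ (m - 1) * (1 - p) ^ (n - m) * (- ln p) ^ (m - 1))" for p :: real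
    define f2 where "f2 p = indicator {0<..} p * (p ^ (m - 1) * exp (- (real n * p)) * (- ln p) ^ (m - 1))" for p :: real
    define g where "g p = indicator {0<..} p * ((p + n * p\<^sup>2) * exp (- (real n * p)) * (p ^ (m - 1) * \<bar>ln p\<bar> ^ (m - 1)))" for p :: real
    have [measurable]: "f1 \<in> borel_measurable borel" "f2 \<in> borel_measurable borel"
      unfolding f1_def f2_def by measurable
    have g: "integrable lborel g" "(\<integral>p. g p \<partial>lborel) \<le> K * ln n ^ (m - 1) / real n ^ (m + 1)"
      using laplace_log_error_integral[OF assms n] unfolding g_def K_def by auto
    have f2: "has_bochner_integral lborel f2 (log_poly m (ln n) / real n ^ m)"
      using laplace_log_integral[OF assms, of n] n unfolding f2_def by simp
    have diff: "\<bar>f1 p - f2 p\<bar> \<le> B * g p" for p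
    proof -
      consider "p \<le> 0" | "0 < p" "p < 1" | "p \<ge> 1" by linarith
      then show ?thesis
      proof cases
        case 2
        then have "f1 p - f2 p = ((1 - p) ^ (n - m) - exp (- (real n * p))) * (p ^ (m - 1) * (- ln p) ^ (m - 1))"
          by (simp add: f1_def f2_def algebra_simps)
        then have "\<bar>f1 p - f2 p\<bar> = \<bar>(1 - p) ^ (n - m) - exp (- (real n * p))\<bar> * (p ^ (m - 1) * \<bar>ln p\<bar> ^ (m - 1))"
          using 2 by (simp add: abs_mult power_abs)
        also have "\<dots> \<le> B * ((p + n * p\<^sup>2) * exp (- (real n * p))) * (p ^ (m - 1) * \<bar>ln p\<bar> ^ (m - 1))"
          unfolding B_def using 2 by (intro mult_right_mono power_one_minus_exp_approx) auto
        finally show ?thesis using 2 by (simp add: g_def mult_ac)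
      next
        \<comment> \<open>Beyond 1 only the exponential integrand survives; its tail is absorbed
          because \<open>B * (p + n * p\<^sup>2)\<close> is at least 1 there.\<close>
        case 3
        then have "\<bar>f1 p - f2 p\<bar> = 1 * exp (- (real n * p)) * (p ^ (m - 1) * \<bar>ln p\<bar> ^ (m - 1))"
          by (simp add: f1_def f2_def abs_mult power_abs)
        also have "\<dots> \<le> (B * (p + n * p\<^sup>2)) * exp (- (real n * p)) * (p ^ (m - 1) * \<bar>ln p\<bar> ^ (m - 1))"
        proof (intro mult_right_mono)
          have "1 * 1 \<le> B * (p + n * p\<^sup>2)"
            using 3 by (intro mult_mono) (auto simp: B_def intro: add_increasing2)
          then show "1 \<le> B * (p + n * p\<^sup>2)" by simp
        qed (use 3 in auto)
        finally show ?thesis using 3 by (simp add: g_def mult_ac)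
      qed (auto simp: f1_def f2_def g_def)
    qed
    have g_nonneg: "g p \<ge> 0" for p by (auto simp: g_def indicator_def)
    have B: "B \<ge> 0" by (simp add: B_def)
    \<comment> \<open>Integrability of \<open>f1\<close> is inherited from \<open>f2\<close> and the
      dominated difference.\<close>
    have int_diff: "integrable lborel (\<lambda>p. f1 p - f2 p)"
      by (rule Bochner_Integration.integrable_bound[OF integrable_mult_right[OF g(1), of B]])
         (use diff g_nonneg B in auto)
    have f1_int: "integrable lborel f1"
      using Bochner_Integration.integrable_add[OF int_diff, of f2] f2
      by (simp add: has_bochner_integral_iff)
    have f1_integral: "beta_log_integral m (n - m) = (\<integral>p. f1 p \<partial>lborel)"
      unfolding beta_log_integral_def by (intro Bochner_Integration.integral_cong) (simp_all add: f1_def)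
    have "beta_log_integral m (n - m) - log_poly m (ln n) / real n ^ m = (\<integral>p. f1 p - f2 p \<partial>lborel)"
      using f1_int f2 by (simp add: has_bochner_integral_iff f1_integral)
    also have "\<bar>\<dots>\<bar> \<le> (\<integral>p. B * g p \<partial>lborel)"
      using int_diff integrable_mult_right[OF g(1), of B] diff
      by (intro order_trans[OF integral_abs_bound] integral_mono integrable_abs) auto
    also have "\<dots> \<le> B * (K * ln n ^ (m - 1) / real n ^ (m + 1))"
      unfolding integral_mult_right_zero by (intro mult_left_mono g(2) B)
    finally show ?thesis by (simp add: mult.assoc)
  qed
  then show ?thesis by blast
qed

text \<open>The factor \<open>n - i\<close> differs from \<open>n\<close> by the relative amount
  \<open>i / n\<close>, and these amounts add up to at most \<open>m\<^sup>2 / n\<close>. The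
  induction step rests on \<open>m\<^sup>2 + m \<le> (m + 1)\<^sup>2\<close>.\<close>

lemma falling_power_approx:
  assumes "m \<le> n"
  shows "0 \<le> (\<Prod>i<m. real (n - i))" "(\<Prod>i<m. real (n - i)) \<le> real n ^ m"
    "real n * (real n ^ m - (\<Prod>i<m. real (n - i))) \<le> real m ^ 2 * real n ^ m"
proof -
  show "0 \<le> (\<Prod>i<m. real (n - i))" by (intro prod_nonneg) auto
  have le: "(\<Prod>i<k. real (n - i)) \<le> real n ^ k" for k
    using prod_mono[of "{..<k}" "\<lambda>i. real (n - i)" "\<lambda>_. real n"] by simp
  then show "(\<Prod>i<m. real (n - i)) \<le> real n ^ m" .
  show "real n * (real n ^ m - (\<Prod>i<m. real (n - i))) \<le> real m ^ 2 * real n ^ m"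
    using assms
  proof (induction m)
    case (Suc m)
    let ?P = "\<Prod>i<m. real (n - i)"
    have "real n * (real n ^ Suc m - (\<Prod>i<Suc m. real (n - i)))
        = real n * (real n * (real n ^ m - ?P)) + real n * (real m * ?P)"
      using Suc.prems by (simp add: algebra_simps of_nat_diff)
    also have "\<dots> \<le> real n * (real m ^ 2 * real n ^ m) + real n * (real m * real n ^ m)"
      using Suc le[of m] by (intro add_mono mult_left_mono) auto
    also have "\<dots> = (real m ^ 2 + real m) * real n ^ Suc m"
      by (simp add: algebra_simps)
    also have "\<dots> \<le> real (Suc m) ^ 2 * real n ^ Suc m"
      by (intro mult_right_mono) (auto simp: power2_eq_square algebra_simps)
    finally show ?case .
  qed auto
qed

section \<open>Combining the errors for one fixed size \<open>m\<close>\<close>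

lemma log_poly_bound:
  assumes "m \<ge> 1"
  shows "\<exists>C. \<forall>L\<ge>1. \<bar>log_poly m L\<bar> \<le> C * L ^ (m - 1)"
proof (intro exI allI impI)
  fix L :: real assume L: "L \<ge> 1"
  have "\<bar>log_poly m L\<bar> \<le> (\<Sum>i\<le>m - 1. \<bar>real (m - 1 choose i) * (- 1) ^ i * log_gamma_moment m i\<bar> * L ^ (m - 1 - i))"
    unfolding log_poly_def using L by (intro order_trans[OF sum_abs]) (simp add: abs_mult)
  also have "\<dots> \<le> (\<Sum>i\<le>m - 1. \<bar>real (m - 1 choose i) * (- 1) ^ i * log_gamma_moment m i\<bar> * L ^ (m - 1))"
    using L by (intro sum_mono mult_left_mono power_increasing) auto
  finally show "\<bar>log_poly m L\<bar> \<le> (\<Sum>i\<le>m - 1. \<bar>real (m - 1 choose i) * (- 1) ^ i * log_gamma_moment m i\<bar>) * L ^ (m - 1)"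
    by (simp add: sum_distrib_right)
qed

lemma beta_log_asymp:
  assumes "m \<ge> 1"
  shows "(\<lambda>n. (\<Prod>i<m. real (n - i)) * beta_log_integral m (n - m) - log_poly m (ln (real n)))
       \<in> O(\<lambda>n. ln (real n) ^ (m - 1) / real n)"
proof -
  obtain C where C: "\<And>n. n \<ge> 3 \<Longrightarrow> \<bar>beta_log_integral m (n - m) - log_poly m (ln (real n)) / real n ^ m\<bar>
             \<le> C * ln (real n) ^ (m - 1) / real n ^ (m + 1)"
    using beta_log_integral_approx[OF assms] by auto
  obtain D where D: "\<And>L. L \<ge> 1 \<Longrightarrow> \<bar>log_poly m L\<bar> \<le> D * L ^ (m - 1)"
    using log_poly_bound[OF assms] by auto
  have "norm ((\<Prod>i<m. real (n - i)) * beta_log_integral m (n - m) - log_poly m (ln (real n)))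
      \<le> (C + real m ^ 2 * D) * norm (ln (real n) ^ (m - 1) / real n)" if n: "n \<ge> max m 3" for n
  proof -
    let ?P = "\<Prod>i<m. real (n - i)" and ?I = "beta_log_integral m (n - m)" and ?Q = "log_poly m (ln (real n))"
    note P = falling_power_approx[of m n]
    have ln_n: "ln (real n) \<ge> 1"
      using n exp_le by (subst ln_ge_iff) auto
    have npos: "real n > 0" using n by simp
    \<comment> \<open>The first term carries the error of the integral, the second that of replacing
      the falling factorial by \<open>n ^ m\<close>; both are of order
      \<open>ln n ^ (m - 1) / n\<close>.\<close>
    have "?P * ?I - ?Q = ?P * (?I - ?Q / real n ^ m) - (real n ^ m - ?P) / real n ^ m * ?Q"
      using npos by (simp add: field_simps)
    also have "\<bar>\<dots>\<bar> \<le> ?P * \<bar>?I - ?Q / real n ^ m\<bar> + (real n ^ m - ?P) / real n ^ m * \<bar>?Q\<bar>"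
      using P n by (intro order_trans[OF abs_triangle_ineq4]) (auto simp: abs_mult)
    also have "\<dots> \<le> real n ^ m * (C * ln (real n) ^ (m - 1) / real n ^ (m + 1))
        + (real m ^ 2 / n) * (D * ln (real n) ^ (m - 1))"
    proof (intro add_mono mult_mono)
      have "(real n ^ m - ?P) / real n ^ m \<le> real m ^ 2 / n"
        using P(3) n npos by (simp add: field_simps)
      then show "(real n ^ m - ?P) / real n ^ m \<le> real m ^ 2 / n" by simp
    qed (use P n C[of n] D[OF ln_n] in auto)
    also have "\<dots> = (C + real m ^ 2 * D) * (ln (real n) ^ (m - 1) / real n)"
      using npos by (simp add: field_simps)
    finally show ?thesis using ln_n by simp
  qed
  then show ?thesis
    by (intro bigoI eventually_at_top_linorderI[of "max m 3"])
qed

section \<open>Generators as selections of observations\<close>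

text \<open>The restriction to \<open>{..<d}\<close> makes the point extensional like the elements
  of \<open>unit_cube\<close>, so that equality of points is equality of the first \<open>d\<close>
  coordinates.\<close>

definition candidate :: "nat \<Rightarrow> nat set \<Rightarrow> (nat \<Rightarrow> nat) \<Rightarrow> (nat \<Rightarrow> nat \<Rightarrow> real) \<Rightarrow> nat \<Rightarrow> real" where
  "candidate d J f X = (\<lambda>j\<in>{..<d}. if j \<in> J then X (f j) j else 0)"

text \<open>Strict positivity in the first clause makes \<open>J\<close> the exact support of the
  candidate; together with the upper bound 1 it also places the candidate in the cube. The second
  clause is membership in the record-setting region, the third says that observation
  \<open>f j\<close> blocks every decrease in direction \<open>j\<close>.\<close>

definition generating :: "nat \<Rightarrow> nat \<Rightarrow> nat set \<Rightarrow> (nat \<Rightarrow> nat) \<Rightarrow> (nat \<Rightarrow> nat \<Rightarrow> real) \<Rightarrow> bool" where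
  "generating d n J f X \<longleftrightarrow>
     (\<forall>j\<in>J. 0 < X (f j) j \<and> X (f j) j < 1) \<and>
     (\<forall>i<n. \<not> strictly_below d (candidate d J f X) (X i)) \<and>
     (\<forall>j\<in>J. \<forall>k<d. k \<noteq> j \<longrightarrow> candidate d J f X k < X (f j) k)"

definition selections :: "nat \<Rightarrow> nat \<Rightarrow> (nat set \<times> (nat \<Rightarrow> nat)) set" where
  "selections d n = (SIGMA J:Pow {..<d}. J \<rightarrow>\<^sub>E {..<n})"

lemma finite_selections [simp]: "finite (selections d n)"
  unfolding selections_def
  by (intro finite_SigmaI finite_PiE) (auto intro: finite_subset)

lemma candidate_simps:
  "j < d \<Longrightarrow> j \<in> J \<Longrightarrow> candidate d J f X j = X (f j) j"
  "j < d \<Longrightarrow> j \<notin> J \<Longrightarrow> candidate d J f X j = 0"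
  by (simp_all add: candidate_def)

text \<open>
  If no observation touches \<open>g\<close> in direction \<open>j\<close>, the coordinate \<open>g j\<close> can be lowered to the next
  observed value below it (or to 0) without leaving the record-setting region.
\<close>

lemma generators_iff:
  "g \<in> generators d n X \<longleftrightarrow> g \<in> record_region d n X \<and>
     (\<forall>j<d. g j = 0 \<or> (\<exists>i<n. X i j = g j \<and> (\<forall>k<d. k \<noteq> j \<longrightarrow> g k < X i k)))"
  (is "_ \<longleftrightarrow> _ \<and> ?touch")
proof (intro iffI conjI allI impI)
  assume g: "g \<in> generators d n X"
  then show reg: "g \<in> record_region d n X" by (simp add: generators_def)
  fix j assume j: "j < d"
  show "g j = 0 \<or> (\<exists>i<n. X i j = g j \<and> (\<forall>k<d. k \<noteq> j \<longrightarrow> g k < X i k))"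
  proof (rule ccontr)
    assume neg: "\<not> ?thesis"
    \<comment> \<open>Including 0 keeps \<open>S\<close> nonempty and its maximum nonnegative, so
      the lowered point stays in the cube.\<close>
    define S where "S = insert 0 ((\<lambda>i. X i j) ` {i. i < n \<and> X i j < g j})"
    define y where "y = g(j := Max S)"
    have S: "finite S" "S \<noteq> {}" by (auto simp: S_def)
    have g01: "0 \<le> g j" "g j < 1" and g_cube: "g \<in> unit_cube d"
      using reg j by (auto simp: record_region_def unit_cube_def PiE_iff)
    have "0 < g j" using neg g01 by auto
    then have Max_less: "Max S < g j" using S by (auto simp: S_def)
    moreover have "0 \<le> Max S" using S by (auto simp: S_def)
    moreover have "Max S < 1" using Max_less g01 by simp
    ultimately have y_cube: "y \<in> unit_cube d"
      using g_cube j unfolding unit_cube_def y_def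
      by (auto simp: PiE_iff extensional_def)
    have "\<not> strictly_below d y (X i)" if i: "i < n" for i
    proof
      assume below: "strictly_below d y (X i)"
      then have other: "g k < X i k" if "k < d" "k \<noteq> j" for k
        using that by (auto simp: strictly_below_def y_def)
      have "\<not> strictly_below d g (X i)"
        using reg i by (auto simp: record_region_def)
      with other have "X i j \<le> g j"
        unfolding strictly_below_def by (metis not_less)
      moreover have "X i j \<noteq> g j"
        using neg i other by auto
      ultimately have "X i j \<in> S" using i by (auto simp: S_def)
      then have "X i j \<le> Max S" using S by simp
      then show False
        using below j by (auto simp: strictly_below_def y_def)
    qed
    with y_cube have "y \<in> record_region d n X" by (simp add: record_region_def)
    moreover have "weakly_below d y g"
      using Max_less by (auto simp: weakly_below_def y_def)
    ultimately have "y = g" using g by (auto simp: generators_def)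
    then show False using Max_less by (metis fun_upd_same less_irrefl y_def)
  qed
next
  assume *: "g \<in> record_region d n X \<and> ?touch"
  \<comment> \<open>Conversely, a point weakly below \<open>g\<close> and smaller in coordinate
    \<open>j\<close> would lie strictly below the observation that touches \<open>g\<close> in
    direction \<open>j\<close>.\<close>
  have "y = g" if y: "y \<in> record_region d n X" "weakly_below d y g" for y
  proof (rule ccontr)
    assume "y \<noteq> g"
    have cube: "y \<in> unit_cube d" "g \<in> unit_cube d" using y * by (auto simp: record_region_def)
    with \<open>y \<noteq> g\<close> obtain j where j: "j < d" "y j \<noteq> g j"
      unfolding unit_cube_def by (metis PiE_ext lessThan_iff)
    then have less: "y j < g j" using y by (auto simp: weakly_below_def less_le)
    have "0 \<le> y j" using cube j by (auto simp: unit_cube_def PiE_iff)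
    then obtain i where i: "i < n" "X i j = g j" "\<And>k. k < d \<Longrightarrow> k \<noteq> j \<Longrightarrow> g k < X i k"
      using * j less by force
    have "strictly_below d y (X i)"
      unfolding strictly_below_def
      using i less y(2) by (metis le_less_trans weakly_below_def)
    then show False using y i by (auto simp: record_region_def)
  qed
  then show "g \<in> generators d n X" using * by (auto simp: generators_def)
qed

text \<open>Choosing a touching observation for each nonzero coordinate yields a selection. The
  equality of sets holds for every \<open>X\<close>, even with ties; only the uniqueness of the
  selection requires their absence.\<close>

lemma generators_eq:
  "generators d n X =
     (\<lambda>(J, f). candidate d J f X) ` {(J, f) \<in> selections d n. generating d n J f X}"
proof (intro equalityI subsetI)
  fix g assume "g \<in> generators d n X"
  then have g: "g \<in> record_region d n X"
      "\<And>j. j < d \<Longrightarrow> g j \<noteq> 0 \<Longrightarrow> \<exists>i<n. X i j = g j \<and> (\<forall>k<d. k \<noteq> j \<longrightarrow> g k < X i k)"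
    unfolding generators_iff by blast+
  have cube: "g \<in> unit_cube d" using g by (simp add: record_region_def)
  define J where "J = {j. j < d \<and> g j \<noteq> 0}"
  have "\<forall>j\<in>J. \<exists>i. i < n \<and> X i j = g j \<and> (\<forall>k<d. k \<noteq> j \<longrightarrow> g k < X i k)"
    using g(2) by (auto simp: J_def)
  from bchoice[OF this] obtain h where h: "\<forall>j\<in>J. h j < n \<and> X (h j) j = g j \<and> (\<forall>k<d. k \<noteq> j \<longrightarrow> g k < X (h j) k)"
    by blast
  have cand: "candidate d J (restrict h J) X = g"
  proof
    fix j show "candidate d J (restrict h J) X j = g j"
      using cube h by (cases "j < d") (auto simp: candidate_def J_def unit_cube_def PiE_iff extensional_def)
  qed
  have "0 < g j" if "j \<in> J" for j
    using that cube by (force simp: J_def unit_cube_def PiE_iff)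
  moreover have "g j < 1" if "j \<in> J" for j
    using that cube by (auto simp: J_def unit_cube_def PiE_iff)
  ultimately have "generating d n J (restrict h J) X"
    unfolding generating_def cand using h g(1) unfolding record_region_def by simp
  moreover have "(J, restrict h J) \<in> selections d n"
    using h by (auto simp: selections_def J_def)
  ultimately show "g \<in> (\<lambda>(J, f). candidate d J f X) ` {(J, f) \<in> selections d n. generating d n J f X}"
    using cand by (intro image_eqI[of _ _ "(J, restrict h J)"]) simp_all
next
  fix g assume "g \<in> (\<lambda>(J, f). candidate d J f X) ` {(J, f) \<in> selections d n. generating d n J f X}"
  then obtain J f where Jf: "(J, f) \<in> selections d n" "generating d n J f X" "g = candidate d J f X"
    by auto
  then have J: "J \<subseteq> {..<d}" and f: "\<And>j. j \<in> J \<Longrightarrow> f j < n" by (auto simp: selections_def)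
  have "g \<in> unit_cube d"
    using Jf by (auto simp: unit_cube_def candidate_def generating_def less_imp_le)
  then have "g \<in> record_region d n X"
    using Jf by (simp add: record_region_def generating_def)
  moreover have "g j = 0 \<or> (\<exists>i<n. X i j = g j \<and> (\<forall>k<d. k \<noteq> j \<longrightarrow> g k < X i k))" if "j < d" for j
    using Jf J f that by (cases "j \<in> J") (auto simp: candidate_simps generating_def intro!: exI[of _ "f j"])
  ultimately show "g \<in> generators d n X" unfolding generators_iff by blast
qed

text \<open>An observation serving both \<open>j\<close> and \<open>k\<close> would have to equal
  the candidate in coordinate \<open>k\<close> and also exceed it there.\<close>

lemma generating_imp_inj_on:
  assumes "J \<subseteq> {..<d}" "generating d n J f X"
  shows "inj_on f J"
proof (rule inj_onI, rule ccontr)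
  fix j k assume jk: "j \<in> J" "k \<in> J" "f j = f k" "j \<noteq> k"
  then have "candidate d J f X k < X (f j) k"
    using assms unfolding generating_def by (metis lessThan_iff subsetD)
  with jk assms show False by (auto simp: candidate_def)
qed

text \<open>\<open>J\<close> is recovered as the support of the point, and then \<open>f j\<close>
  as the only observation with the given value in column \<open>j\<close>.\<close>

lemma candidate_inj:
  assumes "\<And>i i' j. i < n \<Longrightarrow> i' < n \<Longrightarrow> j < d \<Longrightarrow> i \<noteq> i' \<Longrightarrow> X i j \<noteq> X i' j"
  shows "inj_on (\<lambda>(J, f). candidate d J f X) {(J, f) \<in> selections d n. generating d n J f X}"
proof (rule inj_onI, clarify)
  fix J f J' f'
  assume Jf: "(J, f) \<in> selections d n" "generating d n J f X"
    and Jf': "(J', f') \<in> selections d n" "generating d n J' f' X"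
    and eq: "candidate d J f X = candidate d J' f' X"
  have support: "j \<in> J \<longleftrightarrow> j < d \<and> candidate d J f X j \<noteq> 0"
    if "(J, f) \<in> selections d n" "generating d n J f X" for J f j
    using that by (auto simp: candidate_def generating_def selections_def)
  have J: "J = J'"
    using support[OF Jf] support[OF Jf'] eq by auto
  have "f j = f' j" for j
  proof (cases "j \<in> J")
    case True
    then have "X (f j) j = X (f' j) j" "j < d" "f j < n" "f' j < n"
      using fun_cong[OF eq, of j] Jf(1) Jf'(1) J
      by (auto simp: candidate_def selections_def)
    then show ?thesis using assms by blast
  qed (use Jf(1) Jf'(1) J in \<open>auto simp: selections_def PiE_def extensional_def\<close>)
  with J show "J = J' \<and> f = f'" by auto
qed

text \<open>Adding an index raises the count by one exactly when its predicate holds and its value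
  is new, so measurability follows by induction. This covers outcomes with ties, where the indexing
  is not injective.\<close>

lemma card_image_borel_measurable:
  assumes "finite I"
    and "\<And>i. i \<in> I \<Longrightarrow> Measurable.pred M (P i)"
    and "\<And>i i'. i \<in> I \<Longrightarrow> i' \<in> I \<Longrightarrow> Measurable.pred M (\<lambda>x. h i x = h i' x)"
  shows "(\<lambda>x. real (card ((\<lambda>i. h i x) ` {i \<in> I. P i x}))) \<in> borel_measurable M"
  using assms
proof (induction I)
  case (insert i I)
  have [measurable]: "Measurable.pred M (\<lambda>x. \<forall>i'\<in>I. P i' x \<longrightarrow> h i' x \<noteq> h i x)"
    using insert by (intro pred_intros_finite pred_intros_logic) auto
  have [measurable]: "Measurable.pred M (P i)" using insert by auto
  have [measurable]: "(\<lambda>x. real (card ((\<lambda>i. h i x) ` {i \<in> I. P i x}))) \<in> borel_measurable M"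
    using insert by auto
  have "real (card ((\<lambda>i. h i x) ` {i' \<in> insert i I. P i' x}))
      = real (card ((\<lambda>i. h i x) ` {i \<in> I. P i x}))
        + (if P i x \<and> (\<forall>i'\<in>I. P i' x \<longrightarrow> h i' x \<noteq> h i x) then 1 else 0)" for x
  proof -
    have "{i' \<in> insert i I. P i' x} = (if P i x then insert i {i \<in> I. P i x} else {i \<in> I. P i x})"
      by auto
    moreover have "finite {i \<in> I. P i x}" using insert by simp
    ultimately show ?thesis
      by (auto simp: card_insert_if image_iff)
  qed
  then show ?case by simp
qed auto

section \<open>Resampling entries of the observations\<close>

definition unif :: "real measure" where
  "unif = uniform_measure lborel {0..<1}"

definition row_measure :: "nat \<Rightarrow> (nat \<Rightarrow> real) measure" where
  "row_measure d = PiM {..<d} (\<lambda>_. unif)"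

lemma obs_measure_eq: "obs_measure d n = PiM {..<n} (\<lambda>_. row_measure d)"
  by (simp add: obs_measure_def row_measure_def unif_def)

lemma space_unif [simp]: "space unif = UNIV" and sets_unif [measurable_cong, simp]: "sets unif = sets borel"
  by (simp_all add: unif_def)

interpretation unif: prob_space unif
  unfolding unif_def by (intro prob_space_uniform_measure) auto

interpretation unif_prod: product_prob_space "\<lambda>_::nat. unif" I for I
  by standard

interpretation row: prob_space "row_measure d" for d
  unfolding row_measure_def by (intro prob_space_PiM unif.prob_space_axioms)

interpretation row_prod: product_prob_space "\<lambda>_::nat. row_measure d" I for d I
  by standard

interpretation obs: prob_space "obs_measure d n" for d n
  unfolding obs_measure_eq by (intro prob_space_PiM row.prob_space_axioms)

lemma space_row: "space (row_measure d) = {..<d} \<rightarrow>\<^sub>E UNIV"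
  by (simp add: row_measure_def space_PiM)

lemma space_obs: "space (obs_measure d n) = {..<n} \<rightarrow>\<^sub>E ({..<d} \<rightarrow>\<^sub>E UNIV)"
  by (simp add: obs_measure_eq space_PiM space_row)

lemma measurable_row_component:
  "j < d \<Longrightarrow> (\<lambda>y. y j) \<in> borel_measurable (row_measure d)"
  using measurable_component_singleton[of j "{..<d}" "\<lambda>_. unif"]
  by (simp add: row_measure_def cong: measurable_cong_sets)

lemma measurable_obs_row [measurable]:
  "i < n \<Longrightarrow> (\<lambda>X. X i) \<in> obs_measure d n \<rightarrow>\<^sub>M row_measure d"
  using measurable_component_singleton[of i "{..<n}" "\<lambda>_. row_measure d"]
  by (simp add: obs_measure_eq)

lemma measurable_obs_component:
  assumes "i < n" "j < d"
  shows "(\<lambda>X. X i j) \<in> borel_measurable (obs_measure d n)"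
  using measurable_compose[OF measurable_obs_row[OF assms(1)] measurable_row_component[OF assms(2)]] .

lemma nn_integral_unif:
  assumes [measurable]: "f \<in> borel_measurable borel"
  shows "(\<integral>\<^sup>+t. f t \<partial>unif) = (\<integral>\<^sup>+t. f t * indicator {0..<1} t \<partial>lborel)"
  unfolding unif_def by (subst nn_integral_uniform_measure) (auto simp: divide_ennreal_def)

lemma emeasure_unif_greaterThan:
  assumes "0 \<le> a" "a \<le> 1"
  shows "emeasure unif {a<..} = ennreal (1 - a)"
proof -
  have "{0..<1} \<inter> {a<..} = {a<..<1}" using assms by auto
  then show ?thesis using assms by (simp add: unif_def divide_ennreal_def)
qed

lemma AE_unif: "AE t in unif. 0 < t \<and> t < 1"
proof -
  have "AE t in lborel. t \<noteq> (0 :: real)" by (rule AE_lborel_singleton)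
  then show ?thesis
    unfolding unif_def by (intro AE_uniform_measureI) auto
qed

text \<open>Once coordinate \<open>i\<close> is split off, the resampled inner integral no longer
  depends on the old value, which integrates out to total mass one.\<close>

lemma PiM_resample:
  assumes "finite I" "i \<in> I" "\<And>i. prob_space (M i)"
    and [measurable]: "F \<in> borel_measurable (PiM I M)"
  shows "(\<integral>\<^sup>+x. F x \<partial>PiM I M) = (\<integral>\<^sup>+x. (\<integral>\<^sup>+t. F (x(i := t)) \<partial>M i) \<partial>PiM I M)"
proof -
  interpret product_prob_space M I
    using assms(3) by (intro product_prob_spaceI)
  define I' where "I' = I - {i}"
  have I: "I = insert i I'" "i \<notin> I'" "finite I'" using assms by (auto simp: I'_def)
  have upd [measurable]: "(\<lambda>(x, t). x(i := t)) \<in> PiM I M \<Otimes>\<^sub>M M i \<rightarrow>\<^sub>M PiM I M"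
    unfolding split_beta' by (rule measurable_fun_upd[where J = I]) (use I in auto)
  have G: "(\<lambda>x. \<integral>\<^sup>+t. F (x(i := t)) \<partial>M i) \<in> borel_measurable (PiM I M)"
    by measurable
  have "(\<integral>\<^sup>+x. (\<integral>\<^sup>+t. F (x(i := t)) \<partial>M i) \<partial>PiM (insert i I') M)
      = (\<integral>\<^sup>+x. (\<integral>\<^sup>+s. (\<integral>\<^sup>+t. F ((x(i := s))(i := t)) \<partial>M i) \<partial>M i) \<partial>PiM I' M)"
    using G I by (intro product_nn_integral_insert) auto
  also have "\<dots> = (\<integral>\<^sup>+x. (\<integral>\<^sup>+t. F (x(i := t)) \<partial>M i) \<partial>PiM I' M)"
    by (simp add: M.emeasure_space_1)
  also have "\<dots> = (\<integral>\<^sup>+x. F x \<partial>PiM (insert i I') M)"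
    using I assms(4) by (intro product_nn_integral_insert[symmetric]) auto
  finally show ?thesis using I by simp
qed

text \<open>
  Resampling the entries \<open>X (f j) j\<close> that become the coordinates of a generator makes these
  coordinates independent of all rows, after which the rows can be integrated out one by one.
\<close>

definition overwrite :: "nat set \<Rightarrow> (nat \<Rightarrow> nat) \<Rightarrow> (nat \<Rightarrow> real) \<Rightarrow> (nat \<Rightarrow> nat \<Rightarrow> real) \<Rightarrow> nat \<Rightarrow> nat \<Rightarrow> real" where
  "overwrite J f t Y = (\<lambda>i j. if j \<in> J \<and> f j = i then t j else Y i j)"

lemma measurable_overwrite [measurable]:
  assumes "J \<subseteq> {..<d}" "f \<in> J \<rightarrow> {..<n}"
  shows "(\<lambda>(t, Y). overwrite J f t Y) \<in> PiM J (\<lambda>_. unif) \<Otimes>\<^sub>M obs_measure d n \<rightarrow>\<^sub>M obs_measure d n"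
proof -
  let ?N = "PiM J (\<lambda>_. unif) \<Otimes>\<^sub>M obs_measure d n"
  have comp: "(\<lambda>\<omega>. overwrite J f (fst \<omega>) (snd \<omega>) i j) \<in> borel_measurable ?N" if "i < n" "j < d" for i j
  proof (cases "j \<in> J \<and> f j = i")
    case True
    have "(\<lambda>\<omega>. fst \<omega> j) \<in> ?N \<rightarrow>\<^sub>M unif"
      using True by (intro measurable_compose[OF measurable_fst measurable_component_singleton]) auto
    then show ?thesis using True by (simp add: overwrite_def cong: measurable_cong_sets)
  next
    case False
    have "(\<lambda>\<omega>. snd \<omega> i j) \<in> borel_measurable ?N"
      using measurable_compose[OF measurable_snd measurable_obs_component[OF that]] .
    moreover have "(\<lambda>\<omega>. overwrite J f (fst \<omega>) (snd \<omega>) i j) = (\<lambda>\<omega>. snd \<omega> i j)"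
      using False by (auto simp: overwrite_def fun_eq_iff)
    ultimately show ?thesis by simp
  qed
  \<comment> \<open>Writing happens only at positions \<open>(f j, j)\<close> inside the
    \<open>n\<close> by \<open>d\<close> grid, so values outside it remain
    \<open>undefined\<close>.\<close>
  have ext: "overwrite J f t Y \<in> {..<n} \<rightarrow>\<^sub>E ({..<d} \<rightarrow>\<^sub>E UNIV)" if "Y \<in> space (obs_measure d n)" for t Y
  proof -
    have Y: "Y i j = undefined" if "i < n" "\<not> j < d" for i j
      using \<open>Y \<in> _\<close> that by (auto simp: space_obs PiE_iff extensional_def)
    have Y': "Y i = undefined" if "\<not> i < n" for i
      using \<open>Y \<in> _\<close> that by (auto simp: space_obs PiE_iff extensional_def)
    show ?thesis
    proof (intro PiE_I)
      fix i j assume "i \<in> {..<n}" "j \<notin> {..<d}"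
      then show "overwrite J f t Y i j = undefined"
        using Y assms(1) by (auto simp: overwrite_def)
    next
      fix i assume "i \<notin> {..<n}"
      then have "\<not> (j \<in> J \<and> f j = i)" for j using assms(2) by auto
      then have "overwrite J f t Y i = Y i"
        unfolding overwrite_def by (simp only: if_False)
      then show "overwrite J f t Y i = undefined"
        using Y' \<open>i \<notin> _\<close> by simp
    qed auto
  qed
  have row: "(\<lambda>\<omega>. overwrite J f (fst \<omega>) (snd \<omega>) i) \<in> ?N \<rightarrow>\<^sub>M row_measure d" if "i < n" for i
    unfolding row_measure_def
  proof (rule measurable_PiM_single')
    show "(\<lambda>\<omega>. overwrite J f (fst \<omega>) (snd \<omega>) i) \<in> space ?N \<rightarrow> ({..<d} \<rightarrow>\<^sub>E space unif)"
    proof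
      fix \<omega> assume "\<omega> \<in> space ?N"
      then have "snd \<omega> \<in> space (obs_measure d n)" by (auto simp: space_pair_measure)
      from PiE_mem[OF ext[OF this]] that
      show "overwrite J f (fst \<omega>) (snd \<omega>) i \<in> ({..<d} \<rightarrow>\<^sub>E space unif)" by simp
    qed
  qed (use comp that in \<open>auto cong: measurable_cong_sets\<close>)
  have "(\<lambda>\<omega> i. overwrite J f (fst \<omega>) (snd \<omega>) i) \<in> ?N \<rightarrow>\<^sub>M PiM {..<n} (\<lambda>_. row_measure d)"
  proof (rule measurable_PiM_single')
    show "(\<lambda>\<omega> i. overwrite J f (fst \<omega>) (snd \<omega>) i) \<in> space ?N \<rightarrow> ({..<n} \<rightarrow>\<^sub>E space (row_measure d))"
      unfolding space_row by (rule Pi_I, rule ext) (auto simp: space_pair_measure)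
  qed (use row in auto)
  then show ?thesis
    by (simp add: split_beta' flip: obs_measure_eq)
qed

section \<open>Exchanging entries for fresh uniform samples\<close>

lemma measurable_update_row:
  assumes "i < n"
  shows "(\<lambda>(X, y). X(i := y)) \<in> obs_measure d n \<Otimes>\<^sub>M row_measure d \<rightarrow>\<^sub>M obs_measure d n"
  unfolding split_beta' obs_measure_eq
  by (rule measurable_fun_upd[where J = "{..<n}"]) (use assms in auto)

lemma measurable_update_entry:
  assumes "i < n" "j < d"
  shows "(\<lambda>(X, t). X(i := (X i)(j := t))) \<in> obs_measure d n \<Otimes>\<^sub>M unif \<rightarrow>\<^sub>M obs_measure d n"
proof -
  have "(\<lambda>(y, t). y(j := t)) \<in> row_measure d \<Otimes>\<^sub>M unif \<rightarrow>\<^sub>M row_measure d"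
    unfolding split_beta' row_measure_def
    by (rule measurable_fun_upd[where J = "{..<d}"]) (use assms in auto)
  then show ?thesis
    using assms(1) measurable_update_row[OF assms(1), of d] by measurable
qed

text \<open>First the whole row \<open>i\<close> is resampled, then entry \<open>j\<close> inside
  the fresh row; reading the row resampling backwards leaves only the new entry.\<close>

lemma obs_resample_entry:
  assumes "i < n" "j < d" and F [measurable]: "F \<in> borel_measurable (obs_measure d n)"
  shows "(\<integral>\<^sup>+X. F X \<partial>obs_measure d n)
      = (\<integral>\<^sup>+X. (\<integral>\<^sup>+t. F (X(i := (X i)(j := t))) \<partial>unif) \<partial>obs_measure d n)"
proof -
  note upd_row = measurable_update_row[OF assms(1), of d]
  note [measurable] = measurable_update_entry[OF assms(1,2)]
  have "(\<integral>\<^sup>+X. F X \<partial>obs_measure d n) = (\<integral>\<^sup>+X. (\<integral>\<^sup>+y. F (X(i := y)) \<partial>row_measure d) \<partial>obs_measure d n)"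
    using assms unfolding obs_measure_eq
    by (intro PiM_resample row.prob_space_axioms) auto
  also have "\<dots> = (\<integral>\<^sup>+X. (\<integral>\<^sup>+y. (\<integral>\<^sup>+t. F (X(i := y(j := t))) \<partial>unif) \<partial>row_measure d) \<partial>obs_measure d n)"
  proof (rule nn_integral_cong)
    fix X assume X: "X \<in> space (obs_measure d n)"
    have "(\<lambda>y. F (X(i := y))) \<in> borel_measurable (row_measure d)"
      using measurable_compose[OF measurable_compose[OF measurable_Pair1'[OF X] upd_row] F]
      by simp
    then show "(\<integral>\<^sup>+y. F (X(i := y)) \<partial>row_measure d)
        = (\<integral>\<^sup>+y. (\<integral>\<^sup>+t. F (X(i := y(j := t))) \<partial>unif) \<partial>row_measure d)"
      using assms unfolding row_measure_def
      by (intro PiM_resample unif.prob_space_axioms) auto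
  qed
  also have "\<dots> = (\<integral>\<^sup>+X. (\<integral>\<^sup>+y. (\<integral>\<^sup>+t. F ((X(i := y))(i := ((X(i := y)) i)(j := t))) \<partial>unif) \<partial>row_measure d) \<partial>obs_measure d n)"
    by simp
  also have "\<dots> = (\<integral>\<^sup>+X. (\<integral>\<^sup>+t. F (X(i := (X i)(j := t))) \<partial>unif) \<partial>obs_measure d n)"
  proof -
    have "(\<lambda>X. \<integral>\<^sup>+t. F (X(i := (X i)(j := t))) \<partial>unif) \<in> borel_measurable (obs_measure d n)"
      by measurable
    then show ?thesis
      using assms unfolding obs_measure_eq
      by (intro PiM_resample[symmetric] row.prob_space_axioms) auto
  qed
  finally show ?thesis .
qed

lemma obs_resample:
  assumes "J \<subseteq> {..<d}" "f \<in> J \<rightarrow> {..<n}" "F \<in> borel_measurable (obs_measure d n)"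
  shows "(\<integral>\<^sup>+X. F X \<partial>obs_measure d n)
      = (\<integral>\<^sup>+t. (\<integral>\<^sup>+Y. F (overwrite J f t Y) \<partial>obs_measure d n) \<partial>PiM J (\<lambda>_. unif))"
proof -
  have "finite J" using assms(1) finite_subset by blast
  then show ?thesis using assms
  proof (induction J arbitrary: F)
    case empty
    then show ?case
      by (simp add: overwrite_def PiM_empty nn_integral_count_space_finite)
  next
    case (insert j J)
    note F [measurable] = insert.prems(3)
    have ij: "j < d" "f j < n" "J \<subseteq> {..<d}" "f \<in> J \<rightarrow> {..<n}" using insert.prems by auto
    note [measurable] = measurable_overwrite[OF insert.prems(1,2)] measurable_overwrite[OF ij(3,4)]
    note [measurable] = measurable_update_entry[OF ij(2,1)]
    \<comment> \<open>Since \<open>j\<close> is not in \<open>J\<close>, updating one more entry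
      after overwriting along \<open>J\<close> is overwriting along the enlarged set. Fubini then
      joins the new sample \<open>s\<close> to the vector \<open>t\<close>.\<close>
    have ow: "(overwrite J f t Y)(f j := (overwrite J f t Y (f j))(j := s))
        = overwrite (insert j J) f (t(j := s)) Y" for t s Y
      using insert.hyps by (auto simp: overwrite_def fun_eq_iff)
    have "(\<integral>\<^sup>+X. F X \<partial>obs_measure d n)
        = (\<integral>\<^sup>+X. (\<integral>\<^sup>+s. F (X(f j := (X (f j))(j := s))) \<partial>unif) \<partial>obs_measure d n)"
      by (rule obs_resample_entry[OF ij(2,1) F])
    also have "\<dots> = (\<integral>\<^sup>+t. (\<integral>\<^sup>+Y. (\<integral>\<^sup>+s. F (overwrite (insert j J) f (t(j := s)) Y) \<partial>unif) \<partial>obs_measure d n) \<partial>PiM J (\<lambda>_. unif))"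
      unfolding ow[symmetric] by (rule insert.IH[OF ij(3,4)]) measurable
    also have "\<dots> = (\<integral>\<^sup>+t. (\<integral>\<^sup>+s. (\<integral>\<^sup>+Y. F (overwrite (insert j J) f (t(j := s)) Y) \<partial>obs_measure d n) \<partial>unif) \<partial>PiM J (\<lambda>_. unif))"
    proof (rule nn_integral_cong)
      fix t assume t: "t \<in> space (PiM J (\<lambda>_. unif))"
      interpret pair_sigma_finite "obs_measure d n" unif ..
      have [measurable]: "(\<lambda>Y. overwrite J f t Y) \<in> obs_measure d n \<rightarrow>\<^sub>M obs_measure d n"
        using measurable_compose[OF measurable_Pair1'[OF t] measurable_overwrite[OF ij(3,4)]] by simp
      have "(\<lambda>(Y, s). F (overwrite (insert j J) f (t(j := s)) Y)) \<in> borel_measurable (obs_measure d n \<Otimes>\<^sub>M unif)"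
        unfolding ow[symmetric] by measurable
      then show "(\<integral>\<^sup>+Y. (\<integral>\<^sup>+s. F (overwrite (insert j J) f (t(j := s)) Y) \<partial>unif) \<partial>obs_measure d n)
          = (\<integral>\<^sup>+s. (\<integral>\<^sup>+Y. F (overwrite (insert j J) f (t(j := s)) Y) \<partial>obs_measure d n) \<partial>unif)"
        by (rule Fubini'[symmetric])
    qed
    also have "\<dots> = (\<integral>\<^sup>+t. (\<integral>\<^sup>+Y. F (overwrite (insert j J) f t Y) \<partial>obs_measure d n) \<partial>PiM (insert j J) (\<lambda>_. unif))"
      using insert.hyps by (intro unif_prod.product_nn_integral_insert[symmetric]) auto
    finally show ?case .
  qed
qed

text \<open>Resampling one of the two entries shows that a tie forces a uniform variable to hit a
  single prescribed value.\<close>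

lemma AE_no_ties:
  "AE X in obs_measure d n. \<forall>i<n. \<forall>i'<n. \<forall>j<d. i \<noteq> i' \<longrightarrow> X i j \<noteq> X i' j"
proof -
  have "AE X in obs_measure d n. X i j \<noteq> X i' j" if i: "i < n" "i' < n" "j < d" "i \<noteq> i'" for i i' j
  proof -
    let ?T = "{X \<in> space (obs_measure d n). X i j = X i' j}"
    note [measurable] = measurable_obs_component[OF i(1,3)] measurable_obs_component[OF i(2,3)]
    have T [measurable]: "?T \<in> sets (obs_measure d n)" by measurable
    have "emeasure (obs_measure d n) ?T = (\<integral>\<^sup>+X. indicator ?T X \<partial>obs_measure d n)"
      by (simp add: nn_integral_indicator[OF T])
    also have "\<dots> = (\<integral>\<^sup>+X. (\<integral>\<^sup>+t. indicator ?T (X(i := (X i)(j := t))) \<partial>unif) \<partial>obs_measure d n)"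
      using i by (intro obs_resample_entry) auto
    also have "\<dots> = (\<integral>\<^sup>+X. 0 \<partial>obs_measure d n)"
    proof (rule nn_integral_cong)
      fix X
      have "(\<integral>\<^sup>+t. indicator ?T (X(i := (X i)(j := t))) \<partial>unif) \<le> (\<integral>\<^sup>+t. indicator {X i' j} t \<partial>unif)"
        using i by (intro nn_integral_mono) (auto simp: indicator_def)
      also have "\<dots> = emeasure unif {X i' j}"
        by (subst nn_integral_indicator) auto
      also have "\<dots> \<le> 0"
        by (cases "X i' j \<in> {0..<1}") (auto simp: unif_def)
      finally show "(\<integral>\<^sup>+t. indicator ?T (X(i := (X i)(j := t))) \<partial>unif) = 0" by simp
    qed
    finally show ?thesis
      using T by (intro AE_I[of _ _ ?T]) auto
  qed
  then show ?thesis
    by (intro AE_all_countable[THEN iffD2] allI AE_impI)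
qed

section \<open>Probability that a selection generates\<close>

lemma nn_integral_unif_reflect:
  assumes [measurable]: "H \<in> borel_measurable borel"
  shows "(\<integral>\<^sup>+t. H (1 - t) \<partial>unif) = (\<integral>\<^sup>+u. H u * indicator {0<..<1} u \<partial>lborel)"
proof -
  have "(\<integral>\<^sup>+t. H (1 - t) \<partial>unif) = (\<integral>\<^sup>+t. H (1 - t) * indicator {0<..1} (1 - t) \<partial>lborel)"
    by (subst nn_integral_unif) (auto intro!: nn_integral_cong simp: indicator_def)
  also have "\<dots> = (\<integral>\<^sup>+u. H u * indicator {0<..1} u \<partial>lborel)"
    by (subst nn_integral_real_affine[of _ "- 1" 1]) auto
  also have "\<dots> = (\<integral>\<^sup>+u. H u * indicator {0<..<1} u \<partial>lborel)"
    using AE_lborel_singleton[of "1 :: real"]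
    by (intro nn_integral_cong_AE) (auto simp: indicator_def)
  finally show ?thesis .
qed

text \<open>The antiderivative is \<open>- ((- ln p) ^ Suc k / fact (Suc k))\<close>. This integral
  advances the density of a product of uniform variables by one factor.\<close>

lemma nn_integral_neg_ln_power_div:
  assumes "0 < q" "q < 1"
  shows "(\<integral>\<^sup>+p. ennreal ((- ln p) ^ k / fact k / p) * indicator {q..1} p \<partial>lborel)
      = ennreal ((- ln q) ^ Suc k / fact (Suc k))"
proof -
  define w where "w p = indicator {q..1} p * ((- ln p) ^ k / fact k / p)" for p :: real
  have "(\<integral>\<^sup>+p. ennreal ((- ln p) ^ k / fact k / p) * indicator {q..1} p \<partial>lborel)
      = (\<integral>\<^sup>+p. ennreal (w p) * indicator {q..1} p \<partial>lborel)"
    by (intro nn_integral_cong) (auto simp: w_def indicator_def)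
  also have "\<dots> = ennreal (- ((- ln 1) ^ Suc k / fact (Suc k)) - (- ((- ln q) ^ Suc k / fact (Suc k))))"
  proof (rule nn_integral_FTC_Icc)
    show "w \<in> borel_measurable borel" unfolding w_def by measurable
    fix p assume p: "p \<in> {q..1}"
    then show "0 \<le> w p" using assms by (auto simp: w_def)
    have "((\<lambda>p. - ((- ln p) ^ Suc k / fact (Suc k))) has_real_derivative
        - (real (Suc k) * (- ln p) ^ k * (- (1 / p)) / fact (Suc k))) (at p)"
      using p assms by (auto intro!: derivative_eq_intros simp del: power_Suc fact_Suc of_nat_Suc)
    moreover have "- (real (Suc k) * (- ln p) ^ k * (- (1 / p)) / fact (Suc k)) = w p"
      using p assms by (simp add: w_def field_simps del: of_nat_Suc)
    ultimately show "((\<lambda>p. - ((- ln p) ^ Suc k / fact (Suc k))) has_real_derivative w p) (at p)"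
      by metis
  qed (use assms in auto)
  finally show ?thesis by simp
qed

text \<open>Induction by multiplicative convolution: for a further factor \<open>u\<close>,
  substitute \<open>q = u * p\<close>, exchange the integrals, and integrate the old density divided
  by \<open>p\<close> over all \<open>p\<close> above \<open>q\<close>.\<close>

lemma nn_integral_unif_product:
  assumes "finite J" "J \<noteq> {}" "H \<in> borel_measurable borel"
  shows "(\<integral>\<^sup>+t. H (\<Prod>j\<in>J. 1 - t j) \<partial>PiM J (\<lambda>_::nat. unif))
      = (\<integral>\<^sup>+p. H p * ennreal (indicator {0<..<1} p * ((- ln p) ^ (card J - 1) / fact (card J - 1))) \<partial>lborel)"
  using assms
proof (induction J arbitrary: H rule: finite_ne_induct)
  case (singleton j)
  note [measurable] = singleton
  have "(\<lambda>t. H (1 - t)) \<in> borel_measurable unif"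
    by measurable
  then have "(\<integral>\<^sup>+t. H (\<Prod>j\<in>{j}. 1 - t j) \<partial>PiM {j} (\<lambda>_. unif)) = (\<integral>\<^sup>+t. H (1 - t) \<partial>unif)"
    using unif_prod.product_nn_integral_singleton[of "\<lambda>t. H (1 - t)" j] by simp
  also have "\<dots> = (\<integral>\<^sup>+p. H p * indicator {0<..<1} p \<partial>lborel)"
    by (rule nn_integral_unif_reflect) measurable
  finally show ?case by (simp add: ennreal_indicator)
next
  case (insert j J)
  note [measurable] = insert.prems
  define k where "k = card J - 1"
  have card: "card J = Suc k" "card (insert j J) - 1 = Suc k"
    using insert.hyps by (auto simp: k_def card_gt_0_iff)
  define w where "w p = indicator {0<..<1} p * ((- ln p) ^ k / fact k)" for p :: real
  have [measurable]: "w \<in> borel_measurable borel" unfolding w_def by measurable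
  have w_nonneg: "w p \<ge> 0" for p by (auto simp: w_def indicator_def)
  have "(\<integral>\<^sup>+t. H (\<Prod>j\<in>insert j J. 1 - t j) \<partial>PiM (insert j J) (\<lambda>_. unif))
      = (\<integral>\<^sup>+s. (\<integral>\<^sup>+t. H (\<Prod>i\<in>insert j J. 1 - (t(j := s)) i) \<partial>PiM J (\<lambda>_. unif)) \<partial>unif)"
    using insert.hyps by (intro unif_prod.product_nn_integral_insert_rev) auto
  also have "\<dots> = (\<integral>\<^sup>+s. (\<integral>\<^sup>+t. H ((1 - s) * (\<Prod>i\<in>J. 1 - t i)) \<partial>PiM J (\<lambda>_. unif)) \<partial>unif)"
  proof (intro nn_integral_cong arg_cong[where f = H])
    fix s t
    have "(\<Prod>i\<in>J. 1 - (t(j := s)) i) = (\<Prod>i\<in>J. 1 - t i)"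
      using insert.hyps by (intro prod.cong) auto
    then show "(\<Prod>i\<in>insert j J. 1 - (t(j := s)) i) = (1 - s) * (\<Prod>i\<in>J. 1 - t i)"
      using insert.hyps by simp
  qed
  also have "\<dots> = (\<integral>\<^sup>+s. (\<integral>\<^sup>+p. H ((1 - s) * p) * ennreal (w p) \<partial>lborel) \<partial>unif)"
    by (subst insert.IH) (auto simp: w_def k_def)
  also have "\<dots> = (\<integral>\<^sup>+u. (\<integral>\<^sup>+p. H (u * p) * ennreal (w p) \<partial>lborel) * indicator {0<..<1} u \<partial>lborel)"
    by (rule nn_integral_unif_reflect) measurable
  also have "\<dots> = (\<integral>\<^sup>+u. (\<integral>\<^sup>+p. H (u * p) * ennreal (w p) * indicator {0<..<1} u \<partial>lborel) \<partial>lborel)"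
    by (intro nn_integral_cong nn_integral_multc[symmetric]) measurable
  also have "\<dots> = (\<integral>\<^sup>+p. (\<integral>\<^sup>+u. H (u * p) * ennreal (w p) * indicator {0<..<1} u \<partial>lborel) \<partial>lborel)"
    by (rule lborel_pair.Fubini') measurable
  also have "\<dots> = (\<integral>\<^sup>+p. (\<integral>\<^sup>+q. H q * (ennreal (w p / p) * indicator {0<..<p} q) \<partial>lborel) \<partial>lborel)"
  proof (rule nn_integral_cong)
    fix p :: real
    show "(\<integral>\<^sup>+u. H (u * p) * ennreal (w p) * indicator {0<..<1} u \<partial>lborel)
        = (\<integral>\<^sup>+q. H q * (ennreal (w p / p) * indicator {0<..<p} q) \<partial>lborel)"
    proof (cases "p \<in> {0<..<1}")
      case True
      then have p: "p > 0" by simp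
      have "(\<integral>\<^sup>+q. H q * (ennreal (w p / p) * indicator {0<..<p} q) \<partial>lborel)
          = ennreal \<bar>p\<bar> * (\<integral>\<^sup>+u. H (0 + p * u) * (ennreal (w p / p) * indicator {0<..<p} (0 + p * u)) \<partial>lborel)"
        using p by (intro nn_integral_real_affine) auto
      also have "\<dots> = (\<integral>\<^sup>+u. ennreal p * (H (p * u) * (ennreal (w p / p) * indicator {0<..<p} (p * u))) \<partial>lborel)"
        using p by (subst nn_integral_cmult) auto
      also have "\<dots> = (\<integral>\<^sup>+u. H (u * p) * ennreal (w p) * indicator {0<..<1} u \<partial>lborel)"
      proof (rule nn_integral_cong)
        fix u
        have "ennreal p * ennreal (w p / p) = ennreal (w p)"
          using p w_nonneg[of p] by (simp flip: ennreal_mult)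
        moreover have "indicator {0<..<p} (p * u) = (indicator {0<..<1} u :: ennreal)"
          using p by (auto simp: indicator_def zero_less_mult_iff)
        ultimately show "ennreal p * (H (p * u) * (ennreal (w p / p) * indicator {0<..<p} (p * u)))
            = H (u * p) * ennreal (w p) * indicator {0<..<1} u"
          by (metis (no_types, lifting) mult.assoc mult.commute mult.left_commute)
      qed
      finally show ?thesis by simp
    qed (simp add: w_def)
  qed
  also have "\<dots> = (\<integral>\<^sup>+q. (\<integral>\<^sup>+p. H q * (ennreal (w p / p) * indicator {0<..<p} q) \<partial>lborel) \<partial>lborel)"
  proof (rule lborel_pair.Fubini')
    \<comment> \<open>The indicated interval varies with \<open>p\<close>; joint measurability is
      therefore shown for the explicit condition on the pair.\<close>
    have "(\<lambda>(q, p). H q * (ennreal (w p / p) * (if 0 < q \<and> q < p then 1 else 0)))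
        \<in> borel_measurable (lborel \<Otimes>\<^sub>M lborel)"
      by measurable
    then show "(\<lambda>(q, p). H q * (ennreal (w p / p) * indicator {0<..<p} q))
        \<in> borel_measurable (lborel \<Otimes>\<^sub>M lborel)"
      by (simp add: indicator_def of_bool_def)
  qed
  also have "\<dots> = (\<integral>\<^sup>+q. H q * ennreal (indicator {0<..<1} q * ((- ln q) ^ Suc k / fact (Suc k))) \<partial>lborel)"
  proof (rule nn_integral_cong)
    fix q :: real
    have "(\<integral>\<^sup>+p. H q * (ennreal (w p / p) * indicator {0<..<p} q) \<partial>lborel)
        = H q * (\<integral>\<^sup>+p. ennreal (w p / p) * (if 0 < q \<and> q < p then 1 else 0) \<partial>lborel)"
      by (subst nn_integral_cmult[symmetric]) (auto simp: indicator_def of_bool_def)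
    also have "(\<integral>\<^sup>+p. ennreal (w p / p) * (if 0 < q \<and> q < p then 1 else 0) \<partial>lborel)
        = ennreal (indicator {0<..<1} q * ((- ln q) ^ Suc k / fact (Suc k)))"
    proof (cases "0 < q \<and> q < 1")
      case True
      \<comment> \<open>The density \<open>w\<close> supplies the upper limit 1, and the two
        endpoints form a null set.\<close>
      have "(\<integral>\<^sup>+p. ennreal (w p / p) * (if 0 < q \<and> q < p then 1 else 0) \<partial>lborel)
          = (\<integral>\<^sup>+p. ennreal ((- ln p) ^ k / fact k / p) * indicator {q..1} p \<partial>lborel)"
        using AE_lborel_singleton[of q] AE_lborel_singleton[of "1 :: real"] True
        by (intro nn_integral_cong_AE) (auto simp: w_def indicator_def)
      also have "\<dots> = ennreal ((- ln q) ^ Suc k / fact (Suc k))"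
        using True by (intro nn_integral_neg_ln_power_div) auto
      finally show ?thesis using True by (simp del: power_Suc fact_Suc)
    next
      case False
      then have zero: "(\<lambda>p. ennreal (w p / p) * (if 0 < q \<and> q < p then 1 else 0)) = (\<lambda>_. 0)"
        by (auto simp: w_def indicator_def fun_eq_iff)
      show ?thesis unfolding zero using False by (auto simp: indicator_def)
    qed
    finally show "(\<integral>\<^sup>+p. H q * (ennreal (w p / p) * indicator {0<..<p} q) \<partial>lborel)
        = H q * ennreal (indicator {0<..<1} q * ((- ln q) ^ Suc k / fact (Suc k)))" .
  qed
  finally show ?case unfolding card .
qed

text \<open>The set \<open>K\<close> covers both kinds of rows: all columns for an unselected
  observation, all but column \<open>j\<close> for observation \<open>f j\<close>.\<close>

lemma emeasure_row_above:
  assumes "\<And>k. k < d \<Longrightarrow> 0 \<le> g k \<and> g k \<le> 1"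
  shows "emeasure (row_measure d) {y \<in> space (row_measure d). \<forall>k<d. k \<in> K \<longrightarrow> g k < y k}
      = ennreal (\<Prod>k\<in>K \<inter> {..<d}. 1 - g k)"
proof -
  have "{y \<in> space (row_measure d). \<forall>k<d. k \<in> K \<longrightarrow> g k < y k}
      = (\<Pi>\<^sub>E k\<in>{..<d}. if k \<in> K then {g k<..} else UNIV)"
  proof (rule set_eqI)
    fix y :: "nat \<Rightarrow> real"
    have "y k \<in> (if k \<in> K then {g k<..} else UNIV) \<longleftrightarrow> (k \<in> K \<longrightarrow> g k < y k)" for k
      by simp
    then show "y \<in> {y \<in> space (row_measure d). \<forall>k<d. k \<in> K \<longrightarrow> g k < y k}
        \<longleftrightarrow> y \<in> (\<Pi>\<^sub>E k\<in>{..<d}. if k \<in> K then {g k<..} else UNIV)"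
      unfolding space_row PiE_iff mem_Collect_eq by (simp only: UNIV_I lessThan_iff Ball_def) blast
  qed
  also have "emeasure (row_measure d) \<dots> = (\<Prod>k<d. emeasure unif (if k \<in> K then {g k<..} else UNIV))"
    unfolding row_measure_def by (subst unif_prod.emeasure_PiM) auto
  also have "\<dots> = (\<Prod>k<d. if k \<in> K then ennreal (1 - g k) else 1)"
    using assms unif.emeasure_space_1 by (intro prod.cong) (auto simp: emeasure_unif_greaterThan)
  also have "\<dots> = (\<Prod>k\<in>K \<inter> {..<d}. ennreal (1 - g k))"
    by (subst Int_commute, subst prod.inter_restrict) auto
  also have "\<dots> = ennreal (\<Prod>k\<in>K \<inter> {..<d}. 1 - g k)"
    using assms by (intro prod_ennreal) auto
  finally show ?thesis .
qed

text \<open>Each \<open>c k\<close> occurs once for every other index \<open>j\<close>, hence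
  \<open>card J - 1\<close> times. The proof multiplies by the full product and cancels it.\<close>

lemma prod_prod_remove:
  fixes c :: "'a \<Rightarrow> real"
  assumes "finite J" "\<And>j. j \<in> J \<Longrightarrow> c j \<noteq> 0"
  shows "(\<Prod>j\<in>J. \<Prod>k\<in>J - {j}. c k) = (\<Prod>j\<in>J. c j) ^ (card J - 1)"
proof (cases "J = {}")
  case False
  have "(\<Prod>j\<in>J. \<Prod>k\<in>J - {j}. c k) * (\<Prod>j\<in>J. c j) = (\<Prod>j\<in>J. (\<Prod>k\<in>J - {j}. c k) * c j)"
    by (simp add: prod.distrib)
  also have "\<dots> = (\<Prod>j\<in>J. \<Prod>k\<in>J. c k)"
    using assms(1) by (intro prod.cong) (auto simp: prod.remove mult.commute)
  also have "\<dots> = (\<Prod>j\<in>J. c j) ^ (card J - 1) * (\<Prod>j\<in>J. c j)"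
    using False assms(1) by (simp add: card_gt_0_iff flip: power_Suc2)
  finally show ?thesis using assms by simp
qed simp

lemma pred_generating:
  assumes "J \<subseteq> {..<d}" "f \<in> J \<rightarrow> {..<n}"
  shows "Measurable.pred (obs_measure d n) (generating d n J f)"
proof -
  have X: "(\<lambda>X. X i j) \<in> borel_measurable (obs_measure d n)" if "i < n" "j < d" for i j
    using measurable_obs_component[OF that] .
  have cand: "(\<lambda>X. candidate d J f X k) \<in> borel_measurable (obs_measure d n)" if "k < d" for k
  proof (cases "k \<in> J")
    case True
    then have "f k < n" using assms by auto
    with True that show ?thesis using X by (simp add: candidate_simps)
  qed (use that in \<open>simp add: candidate_simps\<close>)
  have "finite J" using assms finite_subset by blast
  then show ?thesis
    unfolding generating_def strictly_below_def
    using assms X cand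
    by (intro pred_intros_logic pred_intros_finite pred_intros_countable pred_intros_imp'
        borel_measurable_pred_less borel_measurable_const) auto
qed

lemma AE_unif_PiM:
  assumes "finite J"
  shows "AE t in PiM J (\<lambda>_. unif). \<forall>j\<in>J. 0 < t j \<and> t j < 1"
  using assms by (intro AE_finite_allI AE_PiM_component unif.prob_space_axioms AE_unif)

text \<open>For fixed \<open>t\<close> the candidate no longer depends on \<open>Y\<close>, so the
  event splits into conditions on single rows. Injectivity ensures that row \<open>f j\<close> is
  overwritten in column \<open>j\<close> only.\<close>

lemma generating_overwrite_iff:
  assumes "J \<subseteq> {..<d}" "f \<in> J \<rightarrow> {..<n}" "inj_on f J" "\<forall>j\<in>J. 0 < t j \<and> t j < 1"
  defines "g \<equiv> \<lambda>k. if k \<in> J then t k else 0"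
  shows "generating d n J f (overwrite J f t Y) \<longleftrightarrow>
     (\<forall>j\<in>J. \<forall>k<d. k \<noteq> j \<longrightarrow> g k < Y (f j) k) \<and>
     (\<forall>i<n. i \<notin> f ` J \<longrightarrow> \<not> (\<forall>k<d. g k < Y i k))"
proof -
  let ?X = "overwrite J f t Y"
  have at: "?X (f j) j = t j" if "j \<in> J" for j
    using that by (simp add: overwrite_def)
  have cand: "candidate d J f ?X k = g k" if "k < d" for k
    using that at by (simp add: candidate_def g_def)
  have off: "?X (f j) k = Y (f j) k" if "j \<in> J" "k \<noteq> j" for j k
    using that assms(3) by (auto simp: overwrite_def dest: inj_onD)
  have other: "?X i k = Y i k" if "i \<notin> f ` J" for i k
    using that by (auto simp: overwrite_def)
  \<comment> \<open>A selected row ties with the candidate in its own column, so it can never exceed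
    it everywhere.\<close>
  have touched: "\<not> strictly_below d (candidate d J f ?X) (?X (f j))" if "j \<in> J" for j
  proof
    assume "strictly_below d (candidate d J f ?X) (?X (f j))"
    moreover have "j < d" using that assms(1) by auto
    ultimately have "g j < t j" using cand at that by (metis strictly_below_def)
    then show False using that by (simp add: g_def)
  qed
  have "(\<forall>i<n. \<not> strictly_below d (candidate d J f ?X) (?X i))
      \<longleftrightarrow> (\<forall>i<n. i \<notin> f ` J \<longrightarrow> \<not> strictly_below d (candidate d J f ?X) (?X i))"
    using touched by blast
  also have "\<dots> \<longleftrightarrow> (\<forall>i<n. i \<notin> f ` J \<longrightarrow> \<not> (\<forall>k<d. g k < Y i k))"
    using cand other by (simp add: strictly_below_def)
  finally have 1: "(\<forall>i<n. \<not> strictly_below d (candidate d J f ?X) (?X i))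
      \<longleftrightarrow> (\<forall>i<n. i \<notin> f ` J \<longrightarrow> \<not> (\<forall>k<d. g k < Y i k))" .
  have 2: "(\<forall>j\<in>J. \<forall>k<d. k \<noteq> j \<longrightarrow> candidate d J f ?X k < ?X (f j) k)
      \<longleftrightarrow> (\<forall>j\<in>J. \<forall>k<d. k \<noteq> j \<longrightarrow> g k < Y (f j) k)"
    using cand off by simp
  show ?thesis
    unfolding generating_def 1 2 using assms(4) at by auto
qed

text \<open>Given \<open>t\<close>, the rows are independent. Row \<open>f j\<close> contributes the
  product of \<open>1 - t k\<close> over the other indices \<open>k\<close> in \<open>J\<close>;
  each of the \<open>n - card J\<close> unselected rows contributes one minus the full
  product.\<close>

lemma emeasure_generating:
  assumes J: "J \<subseteq> {..<d}" and f: "f \<in> J \<rightarrow> {..<n}" and inj: "inj_on f J"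
  shows "emeasure (obs_measure d n) {X \<in> space (obs_measure d n). generating d n J f X}
     = (\<integral>\<^sup>+t. ennreal ((\<Prod>j\<in>J. 1 - t j) ^ (card J - 1) * (1 - (\<Prod>j\<in>J. 1 - t j)) ^ (n - card J))
          \<partial>PiM J (\<lambda>_. unif))"
proof -
  let ?E = "{X \<in> space (obs_measure d n). generating d n J f X}"
  have finJ: "finite J" using J finite_subset by blast
  have E: "?E \<in> sets (obs_measure d n)"
    using pred_generating[OF J f] by measurable
  have "emeasure (obs_measure d n) ?E = (\<integral>\<^sup>+X. indicator ?E X \<partial>obs_measure d n)"
    by (simp add: nn_integral_indicator[OF E])
  also have "\<dots> = (\<integral>\<^sup>+t. (\<integral>\<^sup>+Y. indicator ?E (overwrite J f t Y) \<partial>obs_measure d n) \<partial>PiM J (\<lambda>_. unif))"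
    using E by (intro obs_resample J f) auto
  also have "\<dots> = (\<integral>\<^sup>+t. ennreal ((\<Prod>j\<in>J. 1 - t j) ^ (card J - 1) * (1 - (\<Prod>j\<in>J. 1 - t j)) ^ (n - card J))
          \<partial>PiM J (\<lambda>_. unif))"
  proof (rule nn_integral_cong_AE)
    show "AE t in PiM J (\<lambda>_. unif). (\<integral>\<^sup>+Y. indicator ?E (overwrite J f t Y) \<partial>obs_measure d n)
        = ennreal ((\<Prod>j\<in>J. 1 - t j) ^ (card J - 1) * (1 - (\<Prod>j\<in>J. 1 - t j)) ^ (n - card J))"
      using AE_unif_PiM[OF finJ] AE_space
    proof eventually_elim
      case (elim t)
      note t = elim(1)
      define g where "g k = (if k \<in> J then t k else 0)" for k
      have g: "0 \<le> g k \<and> g k \<le> 1" for k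
        using t by (auto simp: g_def less_imp_le)
      \<comment> \<open>\<open>R i\<close> is the condition imposed on row \<open>i\<close> alone;
        \<open>inv_into\<close> recovers the column in which a selected row was overwritten.\<close>
      define R where "R i = {y \<in> space (row_measure d).
        if i \<in> f ` J then \<forall>k<d. k \<in> - {inv_into J f i} \<longrightarrow> g k < y k
        else \<not> (\<forall>k<d. k \<in> UNIV \<longrightarrow> g k < y k)}" for i
      have above [measurable]: "{y \<in> space (row_measure d). \<forall>k<d. k \<in> K \<longrightarrow> g k < y k} \<in> sets (row_measure d)" for K
      proof -
        have "Measurable.pred (row_measure d) (\<lambda>y. \<forall>k<d. k \<in> K \<longrightarrow> g k < y k)"
          by (intro pred_intros_countable pred_intros_imp' borel_measurable_pred_less
              borel_measurable_const measurable_row_component)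
        then show ?thesis by measurable
      qed
      have compl: "{y \<in> space (row_measure d). \<not> (\<forall>k<d. k \<in> UNIV \<longrightarrow> g k < y k)}
          = space (row_measure d) - {y \<in> space (row_measure d). \<forall>k<d. k \<in> UNIV \<longrightarrow> g k < y k}"
        by auto
      have R [measurable]: "R i \<in> sets (row_measure d)" for i
        unfolding R_def using above[of UNIV] above[of "- {inv_into J f i}"]
        by (cases "i \<in> f ` J") (simp_all only: if_True if_False compl sets.compl_sets)
      define P where "P = (\<Prod>j\<in>J. 1 - t j)"
      have P: "0 < P" "P \<le> 1"
        using t by (auto simp: P_def intro!: prod_pos prod_le_1)
      \<comment> \<open>Columns outside \<open>J\<close> carry the candidate value 0 and thus a
        factor 1.\<close>
      have prod_g: "(\<Prod>k\<in>K \<inter> {..<d}. 1 - g k) = (\<Prod>k\<in>K \<inter> J. 1 - t k)" for K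
        using J by (intro prod.mono_neutral_cong_right) (auto simp: g_def)
      have R_sel: "emeasure (row_measure d) (R (f j)) = ennreal (\<Prod>k\<in>J - {j}. 1 - t k)" if "j \<in> J" for j
      proof -
        have "R (f j) = {y \<in> space (row_measure d). \<forall>k<d. k \<in> - {j} \<longrightarrow> g k < y k}"
          using that inj by (simp add: R_def)
        moreover have "- {j} \<inter> J = J - {j}" by auto
        ultimately show ?thesis
          using emeasure_row_above[of d g "- {j}"] g prod_g[of "- {j}"] by simp
      qed
      have R_other: "emeasure (row_measure d) (R i) = ennreal (1 - P)" if "i \<notin> f ` J" for i
      proof -
        have "R i = space (row_measure d) - {y \<in> space (row_measure d). \<forall>k<d. k \<in> UNIV \<longrightarrow> g k < y k}"
          unfolding compl[symmetric] using that by (simp add: R_def)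
        moreover have "emeasure (row_measure d) {y \<in> space (row_measure d). \<forall>k<d. k \<in> UNIV \<longrightarrow> g k < y k} = ennreal P"
          using emeasure_row_above[of d g UNIV] g prod_g[of UNIV] by (simp add: P_def)
        ultimately show ?thesis
          using emeasure_compl[OF above[of UNIV]] ennreal_minus[of P 1] P row.emeasure_space_1[of d]
          by simp
      qed
      have split: "indicator ?E (overwrite J f t Y) = (\<Prod>i<n. indicator (R i) (Y i) :: ennreal)"
        if Y: "Y \<in> space (obs_measure d n)" for Y
      proof -
        have Yi: "Y i \<in> space (row_measure d)" if "i < n" for i
          using Y that by (auto simp: space_obs space_row PiE_iff)
        have ow: "overwrite J f t Y \<in> space (obs_measure d n)"
          using measurable_space[OF measurable_overwrite[OF J f], of "(t, Y)"] Y elim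
          by (simp add: space_pair_measure)
        have "generating d n J f (overwrite J f t Y) \<longleftrightarrow> (\<forall>i<n. Y i \<in> R i)"
        proof -
          have "(\<forall>i<n. Y i \<in> R i) \<longleftrightarrow> (\<forall>i<n. i \<in> f ` J \<longrightarrow> Y i \<in> R i) \<and> (\<forall>i<n. i \<notin> f ` J \<longrightarrow> Y i \<in> R i)"
            by blast
          also have "(\<forall>i<n. i \<in> f ` J \<longrightarrow> Y i \<in> R i) \<longleftrightarrow> (\<forall>j\<in>J. Y (f j) \<in> R (f j))"
            using f by auto
          also have "\<dots> \<longleftrightarrow> (\<forall>j\<in>J. \<forall>k<d. k \<noteq> j \<longrightarrow> g k < Y (f j) k)"
            using Yi f inj by (intro ball_cong) (auto simp: R_def)
          also have "(\<forall>i<n. i \<notin> f ` J \<longrightarrow> Y i \<in> R i) \<longleftrightarrow> (\<forall>i<n. i \<notin> f ` J \<longrightarrow> \<not> (\<forall>k<d. g k < Y i k))"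
            using Yi by (simp add: R_def)
          finally show ?thesis
            using generating_overwrite_iff[OF J f inj t, of Y] unfolding g_def by blast
        qed
        moreover have "(\<Prod>i<n. indicator (R i) (Y i) :: ennreal) = of_bool (\<forall>i<n. Y i \<in> R i)"
          by (auto simp: indicator_def)
        ultimately show ?thesis using ow by (simp add: indicator_def)
      qed
      have "(\<integral>\<^sup>+Y. indicator ?E (overwrite J f t Y) \<partial>obs_measure d n)
          = (\<integral>\<^sup>+Y. (\<Prod>i<n. indicator (R i) (Y i)) \<partial>obs_measure d n)"
        by (intro nn_integral_cong split)
      also have "\<dots> = (\<Prod>i<n. emeasure (row_measure d) (R i))"
        unfolding obs_measure_eq
        by (subst row_prod.product_nn_integral_prod) (auto simp: nn_integral_indicator)
      also have "\<dots> = (\<Prod>i\<in>{..<n} - f ` J. emeasure (row_measure d) (R i)) * (\<Prod>i\<in>f ` J. emeasure (row_measure d) (R i))"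
        using f by (intro prod.subset_diff) auto
      also have "(\<Prod>i\<in>{..<n} - f ` J. emeasure (row_measure d) (R i)) = (\<Prod>i\<in>{..<n} - f ` J. ennreal (1 - P))"
        by (intro prod.cong refl R_other) auto
      also have "\<dots> = ennreal ((1 - P) ^ (n - card J))"
      proof -
        have "card ({..<n} - f ` J) = n - card J"
          using f inj finJ by (subst card_Diff_subset) (auto simp: card_image)
        then show ?thesis using P by (simp add: ennreal_power)
      qed
      also have "(\<Prod>i\<in>f ` J. emeasure (row_measure d) (R i)) = (\<Prod>j\<in>J. ennreal (\<Prod>k\<in>J - {j}. 1 - t k))"
        by (subst prod.reindex[OF inj]) (auto intro!: prod.cong R_sel)
      also have "\<dots> = ennreal (\<Prod>j\<in>J. \<Prod>k\<in>J - {j}. 1 - t k)"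
        using t by (intro prod_ennreal prod_nonneg) (auto simp: less_imp_le)
      also have "(\<Prod>j\<in>J. \<Prod>k\<in>J - {j}. 1 - t k) = P ^ (card J - 1)"
        unfolding P_def using finJ t by (intro prod_prod_remove) auto
      finally show ?case
        using P by (simp add: P_def[symmetric] mult.commute flip: ennreal_mult)
    qed
  qed
  finally show ?thesis .
qed

section \<open>The expected number of generators\<close>

text \<open>The empty selection proposes the origin. The empty product is 1, so the general formula
  reduces to \<open>0 ^ n\<close>, which vanishes once there is an observation.\<close>

lemma prob_generating_empty:
  assumes "n \<ge> 1" "f \<in> {} \<rightarrow> {..<n}"
  shows "measure (obs_measure d n) {X \<in> space (obs_measure d n). generating d n {} f X} = 0"
  using emeasure_generating[of "{}" d f n] assms
  by (simp add: measure_def power_0_left)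

lemma prob_generating:
  assumes "J \<subseteq> {..<d}" "f \<in> J \<rightarrow> {..<n}" "inj_on f J" "J \<noteq> {}"
  shows "measure (obs_measure d n) {X \<in> space (obs_measure d n). generating d n J f X}
     = beta_log_integral (card J) (n - card J) / fact (card J - 1)"
proof -
  let ?m = "card J"
  define H where "H p = p ^ (?m - 1) * (1 - p) ^ (n - ?m)" for p :: real
  define w where "w p = indicator {0<..<1} p * ((- ln p) ^ (?m - 1) / fact (?m - 1))" for p :: real
  have [measurable]: "H \<in> borel_measurable borel" "w \<in> borel_measurable borel"
    unfolding H_def w_def by measurable
  have nonneg: "0 \<le> H p * w p" for p by (auto simp: H_def w_def indicator_def)
  have "emeasure (obs_measure d n) {X \<in> space (obs_measure d n). generating d n J f X}
      = (\<integral>\<^sup>+t. ennreal (H (\<Prod>j\<in>J. 1 - t j)) \<partial>PiM J (\<lambda>_. unif))"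
    unfolding H_def by (rule emeasure_generating[OF assms(1,2,3)])
  also have "\<dots> = (\<integral>\<^sup>+p. ennreal (H p) * ennreal (w p) \<partial>lborel)"
    unfolding w_def using assms finite_subset[OF assms(1)]
    by (intro nn_integral_unif_product) auto
  also have "\<dots> = (\<integral>\<^sup>+p. ennreal (H p * w p) \<partial>lborel)"
    by (intro nn_integral_cong ennreal_mult''[symmetric]) (auto simp: w_def indicator_def)
  \<comment> \<open>For a nonnegative measurable integrand the real integral is by definition
    consistent with the nonnegative one, so integrability need not be shown separately.\<close>
  finally have "measure (obs_measure d n) {X \<in> space (obs_measure d n). generating d n J f X}
      = (\<integral>p. H p * w p \<partial>lborel)"
    unfolding measure_def using nonneg by (subst integral_eq_nn_integral) auto
  also have "\<dots> = (\<integral>p. (indicator {0<..<1} p * (p ^ (?m - 1) * (1 - p) ^ (n - ?m) * (- ln p) ^ (?m - 1))) / fact (?m - 1) \<partial>lborel)"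
    by (intro Bochner_Integration.integral_cong) (auto simp: H_def w_def)
  also have "\<dots> = beta_log_integral ?m (n - ?m) / fact (?m - 1)"
    by (simp add: beta_log_integral_def)
  finally show ?thesis .
qed

section \<open>Linearity of expectation and counting of selections\<close>

lemma sum_Pow_card:
  fixes \<phi> :: "nat \<Rightarrow> real"
  assumes "finite A"
  shows "(\<Sum>J\<in>Pow A. \<phi> (card J)) = (\<Sum>m\<le>card A. real (card A choose m) * \<phi> m)"
proof -
  have "(\<Sum>J\<in>Pow A. \<phi> (card J)) = (\<Sum>m\<le>card A. \<Sum>J\<in>{J \<in> Pow A. card J = m}. \<phi> (card J))"
    using assms by (intro sum.group[symmetric]) (auto intro: card_mono)
  also have "\<dots> = (\<Sum>m\<le>card A. real (card A choose m) * \<phi> m)"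
    using n_subsets[OF assms] by (intro sum.cong) auto
  finally show ?thesis .
qed

text \<open>Off the null event of ties, distinct generating selections give distinct generators, so
  the count is a sum of indicators and linearity of expectation applies.\<close>

lemma expected_generators_sum:
  "expected_generators d n = (\<Sum>(J, f)\<in>selections d n.
     measure (obs_measure d n) {X \<in> space (obs_measure d n). generating d n J f X})"
proof -
  let ?M = "obs_measure d n"
  define G where "G s = {X \<in> space ?M. generating d n (fst s) (snd s) X}" for s
  have sel: "fst s \<subseteq> {..<d}" "snd s \<in> fst s \<rightarrow> {..<n}" if "s \<in> selections d n" for s
    using that by (auto simp: selections_def)
  have G: "G s \<in> sets ?M" if "s \<in> selections d n" for s
    unfolding G_def using pred_generating[OF sel[OF that]] by measurable
  have gens: "generators d n X = (\<lambda>s. candidate d (fst s) (snd s) X) `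
      {s \<in> selections d n. generating d n (fst s) (snd s) X}" for X
    unfolding generators_eq by (intro image_cong) auto
  \<comment> \<open>Both sides are extensional, so equality of points reduces to measurable
    conditions on coordinates below \<open>d\<close>.\<close>
  have cand_eq: "candidate d J f X = candidate d J' f' X \<longleftrightarrow> (\<forall>k<d. candidate d J f X k = candidate d J' f' X k)"
    for J f J' f' X
    by (auto simp: candidate_def restrict_def fun_eq_iff)
  have meas: "(\<lambda>X. real (card (generators d n X))) \<in> borel_measurable ?M"
    unfolding gens
  proof (rule card_image_borel_measurable)
    fix s s' assume s: "s \<in> selections d n" "s' \<in> selections d n"
    have "(\<lambda>X. candidate d (fst s) (snd s) X k) \<in> borel_measurable ?M" if "s \<in> selections d n" "k < d" for s k
    proof (cases "k \<in> fst s")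
      case True
      then have "snd s k < n" using sel[OF that(1)] by auto
      with True that show ?thesis by (simp add: candidate_simps measurable_obs_component)
    qed (use that in \<open>simp add: candidate_simps\<close>)
    with s show "Measurable.pred ?M (\<lambda>X. candidate d (fst s) (snd s) X = candidate d (fst s') (snd s') X)"
      unfolding cand_eq by (intro pred_intros_countable pred_intros_imp' pred_def[THEN iffD2] borel_measurable_eq) auto
  qed (auto intro: pred_generating[OF sel])
  have "expected_generators d n = (\<integral>X. real (card (generators d n X)) \<partial>?M)"
    by (simp add: expected_generators_def)
  also have "\<dots> = (\<integral>X. (\<Sum>s\<in>selections d n. indicator (G s) X) \<partial>?M)"
  proof (rule integral_cong_AE)
    show "AE X in ?M. real (card (generators d n X)) = (\<Sum>s\<in>selections d n. indicator (G s) X)"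
      using AE_no_ties[of n d] AE_space
    proof eventually_elim
      case (elim X)
      have "inj_on (\<lambda>s. candidate d (fst s) (snd s) X) {s \<in> selections d n. generating d n (fst s) (snd s) X}"
      proof -
        have "inj_on (\<lambda>(J, f). candidate d J f X) {(J, f) \<in> selections d n. generating d n J f X}"
          using elim(1) by (intro candidate_inj) auto
        moreover have "{(J, f) \<in> selections d n. generating d n J f X}
            = {s \<in> selections d n. generating d n (fst s) (snd s) X}"
          by auto
        ultimately show ?thesis by (simp add: case_prod_beta')
      qed
      then have "card (generators d n X) = card {s \<in> selections d n. generating d n (fst s) (snd s) X}"
        unfolding gens by (rule card_image)
      also have "real \<dots> = (\<Sum>s\<in>selections d n. indicator (G s) X)"
        using elim(2) by (simp add: G_def indicator_def of_bool_def sum.If_cases Int_def)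
      finally show ?case .
    qed
  qed (use meas G in auto)
  also have "\<dots> = (\<Sum>s\<in>selections d n. measure ?M (G s))"
    using G by (subst Bochner_Integration.integral_sum)
      (auto simp: less_top[symmetric] intro!: integrable_real_indicator sum.cong dest: sets.sets_into_space)
  finally show ?thesis by (simp add: G_def case_prod_beta)
qed

text \<open>The probability depends only on the size \<open>m\<close> of \<open>J\<close>: there are
  \<open>d choose m\<close> such sets, and the falling factorial counts the injections into the
  observations.\<close>

lemma expected_generators_eq:
  assumes "n \<ge> 1"
  shows "expected_generators d n = (\<Sum>m\<in>{1..d}. real (d choose m) / fact (m - 1) *
     ((\<Prod>i<m. real (n - i)) * beta_log_integral m (n - m)))"
proof -
  let ?prob = "\<lambda>J f. measure (obs_measure d n) {X \<in> space (obs_measure d n). generating d n J f X}"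
  \<comment> \<open>The value at 0 is set by hand to agree with
    \<open>prob_generating_empty\<close>; with truncated exponents the beta integral itself would be
    positive there.\<close>
  define q where "q m = (if m = 0 then 0 else beta_log_integral m (n - m) / fact (m - 1))" for m
  define \<phi> where "\<phi> m = (\<Prod>i<m. real (n - i)) * q m" for m
  have "(\<Sum>f\<in>J \<rightarrow>\<^sub>E {..<n}. ?prob J f) = \<phi> (card J)" if J: "J \<subseteq> {..<d}" for J
  proof -
    have finJ: "finite J" using J finite_subset by blast
    have "(\<Sum>f\<in>J \<rightarrow>\<^sub>E {..<n}. ?prob J f) = (\<Sum>f\<in>{f \<in> J \<rightarrow>\<^sub>E {..<n}. inj_on f J}. q (card J))"
    proof (rule sum.mono_neutral_cong_right)
      show "\<forall>f\<in>(J \<rightarrow>\<^sub>E {..<n}) - {f \<in> J \<rightarrow>\<^sub>E {..<n}. inj_on f J}. ?prob J f = 0"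
      proof
        fix f assume "f \<in> (J \<rightarrow>\<^sub>E {..<n}) - {f \<in> J \<rightarrow>\<^sub>E {..<n}. inj_on f J}"
        then have "{X \<in> space (obs_measure d n). generating d n J f X} = {}"
          using generating_imp_inj_on[OF J] by blast
        then show "?prob J f = 0" by (metis measure_empty)
      qed
      show "?prob J f = q (card J)" if "f \<in> {f \<in> J \<rightarrow>\<^sub>E {..<n}. inj_on f J}" for f
      proof (cases "J = {}")
        case True
        with assms show ?thesis by (simp add: q_def prob_generating_empty)
      next
        case False
        have "f \<in> J \<rightarrow> {..<n}" "inj_on f J" using that by auto
        with False J finJ show ?thesis by (simp add: q_def prob_generating)
      qed
    qed (use finJ in \<open>auto intro!: finite_PiE\<close>)
    also have "\<dots> = real (card {f \<in> J \<rightarrow>\<^sub>E {..<n}. inj_on f J}) * q (card J)"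
      by simp
    \<comment> \<open>If \<open>card J\<close> exceeds \<open>n\<close>, truncated subtraction
      produces a zero factor, in accordance with the absence of injections.\<close>
    also have "card {f \<in> J \<rightarrow>\<^sub>E {..<n}. inj_on f J} = (\<Prod>i<card J. n - i)"
      using card_inj_on_subset_funcset[of J "{..<n}" J] finJ by (simp add: atLeast0LessThan)
    finally show ?thesis by (simp add: \<phi>_def)
  qed
  then have "expected_generators d n = (\<Sum>J\<in>Pow {..<d}. \<phi> (card J))"
    unfolding expected_generators_sum selections_def
    by (subst sum.Sigma[symmetric]) (auto intro!: sum.cong finite_PiE intro: finite_subset)
  also have "\<dots> = (\<Sum>m\<le>d. real (d choose m) * \<phi> m)"
    using sum_Pow_card[of "{..<d}" \<phi>] by simp
  also have "\<dots> = (\<Sum>m\<in>{1..d}. real (d choose m) * \<phi> m)"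
    by (rule sum.mono_neutral_right) (auto simp: \<phi>_def q_def not_le)
  also have "\<dots> = (\<Sum>m\<in>{1..d}. real (d choose m) / fact (m - 1) *
     ((\<Prod>i<m. real (n - i)) * beta_log_integral m (n - m)))"
    by (intro sum.cong) (auto simp: \<phi>_def q_def)
  finally show ?thesis .
qed

section \<open>Matching the coefficients and conclusion\<close>

lemma coeff_a_0:
  assumes "d \<ge> 1"
  shows "coeff_a d 0 = 1"
  using assms Gamma_fact[of "d - 1", where ?'a = real]
  by (simp add: coeff_a_def of_nat_diff)

text \<open>The double sum is regrouped by powers of \<open>L\<close>: with
  \<open>m = d - j + k\<close> and \<open>i = k\<close>, the exponent \<open>m - 1 - i\<close>
  equals \<open>d - 1 - j\<close>, and the moments become the Gamma derivatives in
  \<open>coeff_a\<close>.\<close>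

lemma log_poly_sum_eq_coeff_a:
  assumes "d \<ge> 1" "L \<noteq> 0"
  shows "(\<Sum>m\<in>{1..d}. real (d choose m) / fact (m - 1) * log_poly m L)
     = L ^ (d - 1) * (\<Sum>j=0..d-1. coeff_a d j * inverse (L ^ j))"
proof -
  define A where "A m i = real (d choose m) / (fact i * fact (m - 1 - i)) * (- 1) ^ i
      * log_gamma_moment (real m) i * L ^ (m - 1 - i)" for m i
  have "real (d choose m) / fact (m - 1) * log_poly m L = (\<Sum>i\<le>m - 1. A m i)" if "m \<in> {1..d}" for m
    unfolding log_poly_def sum_distrib_left A_def
    by (intro sum.cong refl) (simp add: binomial_fact mult_ac)
  then have "(\<Sum>m\<in>{1..d}. real (d choose m) / fact (m - 1) * log_poly m L)
      = (\<Sum>(m, i)\<in>(SIGMA m:{1..d}. {..m - 1}). A m i)"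
    by (simp add: sum.Sigma)
  also have "\<dots> = (\<Sum>(j, k)\<in>(SIGMA j:{0..d - 1}. {0..j}). A (d - j + k) k)"
    by (rule sum.reindex_bij_witness[where i = "\<lambda>(j, k). (d - j + k, k)" and j = "\<lambda>(m, i). (d - m + i, i)"])
       (use assms(1) in auto)
  also have "\<dots> = (\<Sum>j=0..d-1. \<Sum>k=0..j. A (d - j + k) k)"
    by (rule sum.Sigma[symmetric]) auto
  also have "\<dots> = (\<Sum>j=0..d-1. L ^ (d - 1) * (coeff_a d j * inverse (L ^ j)))"
  proof (rule sum.cong)
    fix j assume j: "j \<in> {0..d - 1}"
    have "L ^ (d - 1) = L ^ (d - 1 - j) * L ^ j"
      using j le_add_diff_inverse2[of j "d - 1"] by (metis atLeastAtMost_iff power_add)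
    then have L: "L ^ (d - 1) * inverse (L ^ j) = L ^ (d - 1 - j)"
      using assms(2) by simp
    have "A (d - j + k) k = real (d choose (d - j + k)) * (- 1) ^ k * (deriv ^^ k) Gamma (real (d - j + k))
        / (fact k * fact (d - 1 - j)) * L ^ (d - 1 - j)" if k: "k \<in> {0..j}" for k
    proof -
      have "d - j + k - 1 - k = d - 1 - j" using j k by simp
      moreover have "(deriv ^^ k) Gamma (real (d - j + k)) = log_gamma_moment (real (d - j + k)) k"
        using j assms(1) by (intro higher_deriv_Gamma) auto
      ultimately show ?thesis by (simp add: A_def)
    qed
    then have "(\<Sum>k=0..j. A (d - j + k) k) = coeff_a d j * L ^ (d - 1 - j)"
      unfolding coeff_a_def sum_distrib_right by (intro sum.cong) auto
    then show "(\<Sum>k=0..j. A (d - j + k) k) = L ^ (d - 1) * (coeff_a d j * inverse (L ^ j))"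
      unfolding L[symmetric] by (simp add: mult_ac)
  qed simp
  finally show ?thesis by (simp add: sum_distrib_left)
qed

theorem theoremT:
  fixes d :: nat
  assumes "d \<ge> 1"
  shows "(\<lambda>n::nat. expected_generators d n
            - ln (real n) ^ (d - 1) * (\<Sum>j=0..d-1. coeff_a d j * inverse (ln (real n) ^ j)))
         \<in> O(\<lambda>n. ln (real n) ^ (d - 1) / real n)
       \<and> coeff_a d 0 = 1"
proof
  let ?D = "\<lambda>m n. (\<Prod>i<m. real (n - i)) * beta_log_integral m (n - m) - log_poly m (ln (real n))"
  \<comment> \<open>Since \<open>ln n \<ge> 1\<close> from \<open>n = 3\<close> on, the error for
    each \<open>m\<close> is absorbed by the one for \<open>m = d\<close>.\<close>
  have "?D m \<in> O(\<lambda>n. ln (real n) ^ (d - 1) / real n)" if m: "m \<in> {1..d}" for m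
  proof (rule landau_o.big_trans[OF beta_log_asymp])
    show "(\<lambda>n. ln (real n) ^ (m - 1) / real n) \<in> O(\<lambda>n. ln (real n) ^ (d - 1) / real n)"
    proof (intro bigoI[where c = 1] eventually_at_top_linorderI[of 3])
      fix n :: nat assume n: "3 \<le> n"
      have "ln (real n) \<ge> 1" using n exp_le by (subst ln_ge_iff) auto
      then have "ln (real n) ^ (m - 1) \<le> ln (real n) ^ (d - 1)" "0 \<le> ln (real n) ^ (m - 1)"
        using m by (auto intro!: power_increasing)
      then show "norm (ln (real n) ^ (m - 1) / real n) \<le> 1 * norm (ln (real n) ^ (d - 1) / real n)"
        by (simp add: divide_right_mono)
    qed
  qed (use m in simp)
  then have "(\<lambda>n. \<Sum>m\<in>{1..d}. real (d choose m) / fact (m - 1) * ?D m n)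
      \<in> O(\<lambda>n. ln (real n) ^ (d - 1) / real n)"
    by (intro big_sum_in_bigo landau_o.big.cmult_in_iff[THEN iffD2]) auto
  moreover have "(\<Sum>m\<in>{1..d}. real (d choose m) / fact (m - 1) * ?D m n) = expected_generators d n
            - ln (real n) ^ (d - 1) * (\<Sum>j=0..d-1. coeff_a d j * inverse (ln (real n) ^ j))"
    if n: "n \<ge> 2" for n
  proof -
    \<comment> \<open>At \<open>n = 1\<close> the logarithm vanishes and the inverse powers lose
      their meaning; the exact identity is used from 2 on.\<close>
    have "ln (real n) \<noteq> 0" "n \<ge> 1" using n by auto
    then show ?thesis
      by (simp only: expected_generators_eq log_poly_sum_eq_coeff_a[OF assms, symmetric]
          right_diff_distrib sum_subtractf not_False_eq_True)
  qed
  ultimately show "(\<lambda>n::nat. expected_generators d n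
            - ln (real n) ^ (d - 1) * (\<Sum>j=0..d-1. coeff_a d j * inverse (ln (real n) ^ j)))
         \<in> O(\<lambda>n. ln (real n) ^ (d - 1) / real n)"
    by (subst landau_o.big.in_cong[symmetric, where f = "\<lambda>n. \<Sum>m\<in>{1..d}. real (d choose m) / fact (m - 1) * ?D m n"])
       (auto intro!: eventually_at_top_linorderI[of 2])
  show "coeff_a d 0 = 1" by (rule coeff_a_0[OF assms])
qed

end
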